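(* Let $k\in\mathbb N$ and let $\beta=(\beta_{i,j})_{i,j\in\mathbb Z_+,\,i+j\le2k}$ be a 2-dimensional real multisequence of degree $2k$. Suppose $M(k)$ is positive semidefinite and recursively generated. Let $$u^{(i)}:=(\beta_{1,i},\beta_{0,i+1},\beta_{2,i})\quad\text{for }i=0,\ldots,2k-2,$$ $$\widehat\beta:=(u^{(0)},\ldots,u^{(2k-2)}),\quad\widetilde\beta:=(\widehat\beta,\beta_{1,2k-1},\beta_{0,2k}),\quad\overline\beta:=(\beta_{2,0},u^{(1)},\ldots,u^{(2k-2)}),\quad\breve\beta:=(\overline\beta,\beta_{1,2k-1},\beta_{0,2k})$$ (concatenated sequences), let $v:=(u^{(0)}\ \cdots\ u^{(k-2)}\ \beta_{1,k-1})$ be a row vector and let $$\widetilde A:=\begin{pmatrix} \beta_{0,0} & v \\ v^T & A_{\overline\beta} \end{pmatrix}.$$ Then $\beta$ has a representing measure supported on the curve $y^2=x^3$ if and only if the following statements (1) and (2) hold: (1) One of the following holds: - $k\ge3$ and $Y^2=X^3$ is a column relation of $M(k)$; - $k=2$ and the equalities $\beta_{0,2}=\beta_{3,0}$, $\beta_{1,2}=\beta_{4,0}$, $\beta_{0,3}=\beta_{3,1}$ hold; - $k=1$. (2) One of the following holds: (a) $A_{\widetilde\beta}\succ0$ and $\widetilde A\succ0$. (b) $A_{\widetilde\beta}\succeq0$ and $\operatorname{rank}A_{\widehat\beta}=\operatorname{rank}A_{\widetilde\beta}=\operatorname{rank}A_{\breve\beta}$. Moreover, if a representing measure exists, then there exists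 a $(\operatorname{rank}\widetilde\beta)$-atomic measure if (a) is true or (b) holds with $\operatorname{rank}A_{\widehat\beta}=\operatorname{rank}M(k)$. Otherwise there is a $(\operatorname{rank}\widetilde\beta+1)$-atomic measure.
   Context: $\mathbb N$ is the set of positive integers. For a sequence $\gamma=(\gamma_0,\ldots,\gamma_{2m})$ of odd length, $A_\gamma:=(\gamma_{i+j})_{i,j=0}^m$ is the corresponding Hankel matrix (sequences are re-indexed from $0$). With columns $\mathbf v_0,\ldots,\mathbf v_m$ of $A_\gamma$, the rank of the sequence is $\operatorname{rank}\gamma:=m+1$ if $A_\gamma$ is nonsingular and $\operatorname{rank}\gamma:=\min\{i:\mathbf v_i\in\operatorname{span}\{\mathbf v_0,\ldots,\mathbf v_{i-1}\}\}$ if $A_\gamma$ is singular (the span of the empty set is $\{0\}$). $A\succ0$ ($\succeq0$) means positive (semi)definite. The moment matrix $M(k)$ of $\beta$ has rows and columns indexed by the monomials $X^iY^j$, $i+j\le k$, with entry $\beta_{i_1+i_2,j_1+j_2}$ in row $X^{i_1}Y^{j_1}$ and column $X^{i_2}Y^{j_2}$. For a polynomial $p=\sum a_{ij}x^iy^j$ of degree at most $k$, $p(X,Y)$ denotes the linear combination $\sum a_{ij}X^iY^j$ of columns of $M(k)$. "$Y^2=X^3$ is a column relation" means that the columns indexed by $Y^2$ and $X^3$ coincide. $M(k)$ is recursively generated if for all polynomials $p,q$ with $p,q,pq$ of degree at most $k$, $p(X,Y)=0$ implies $(pq)(X,Y)=0$. A representing measure for $\beta$ supported on a closed set $K\subseteq\mathbb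 R^2$ is a positive Borel measure $\mu$ with support in $K$ such that $\beta_{i,j}=\int_Kx^iy^j\,d\mu$ for all $i+j\le2k$. A measure is $m$-atomic if it is a sum of $m$ point masses with positive weights at distinct points. *)

theory Defs
  imports
    "HOL-Analysis.Analysis"
    "HOL-Library.Poly_Mapping"
    "Jordan_Normal_Form.DL_Rank"
begin

subsection \<open>Matrices\<close>

definition pos_semidef :: "real mat \<Rightarrow> bool" where
  "pos_semidef A \<longleftrightarrow> square_mat A \<and> transpose_mat A = A \<and>
     (\<forall>x \<in> carrier_vec (dim_row A). scalar_prod x (A *\<^sub>v x) \<ge> 0)"

definition pos_def :: "real mat \<Rightarrow> bool" where
  "pos_def A \<longleftrightarrow> square_mat A \<and> transpose_mat A = A \<and>
     (\<forall>x \<in> carrier_vec (dim_row A). x \<noteq> 0\<^sub>v (dim_row A) \<longrightarrow> scalar_prod x (A *\<^sub>v x) > 0)"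

definition mat_rank :: "real mat \<Rightarrow> nat" where
  "mat_rank A = vec_space.rank (dim_row A) A"

definition vec_span :: "nat \<Rightarrow> real Matrix.vec set \<Rightarrow> real Matrix.vec set" where
  "vec_span n S = LinearCombinations.module.span class_ring (module_vec TYPE(real) n) S"


subsection \<open>Hankel matrices and the rank of a sequence\<close>

text \<open>A finite sequence is a list, indexed from 0. The two notions below are only meant for
  lists of odd length \<open>2 * m + 1\<close>, for which \<open>length \<gamma> div 2 = m\<close>.\<close>

definition hankel :: "real list \<Rightarrow> real mat" where
  "hankel \<gamma> = Matrix.mat (length \<gamma> div 2 + 1) (length \<gamma> div 2 + 1) (\<lambda>(i, j). \<gamma> ! (i + j))"

text \<open>The rank of a sequence is in general not the rank of its Hankel matrix.\<close>

definition seq_rank :: "real list \<Rightarrow> nat" where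
  "seq_rank \<gamma> =
     (let m = length \<gamma> div 2; A = hankel \<gamma> in
      if invertible_mat A then m + 1
      else (LEAST i. i \<le> m \<and> col A i \<in> vec_span (m + 1) {col A j | j. j < i}))"


subsection \<open>Moment matrices\<close>

text \<open>The pair \<open>(i, j)\<close> stands for the monomial \<open>x^i y^j\<close>. The monomials of degree at most \<open>k\<close>
  are listed in the order \<open>1, X, Y, X^2, XY, Y^2, \<dots>\<close>. A bidegree-indexed multisequence is a
  function \<open>\<beta> :: nat \<Rightarrow> nat \<Rightarrow> real\<close>; for a multisequence of degree \<open>2 * k\<close> only the values
  \<open>\<beta> i j\<close> with \<open>i + j \<le> 2 * k\<close> are ever used.\<close>

definition monomials :: "nat \<Rightarrow> (nat \<times> nat) list" where
  "monomials k = concat (map (\<lambda>d. map (\<lambda>j. (d - j, j)) [0..<Suc d]) [0..<Suc k])"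

definition moment_matrix :: "(nat \<Rightarrow> nat \<Rightarrow> real) \<Rightarrow> nat \<Rightarrow> real mat" where
  "moment_matrix \<beta> k =
     Matrix.mat (length (monomials k)) (length (monomials k))
       (\<lambda>(r, c). \<beta> (fst (monomials k ! r) + fst (monomials k ! c))
                     (snd (monomials k ! r) + snd (monomials k ! c)))"

text \<open>Multiplication of finitely supported maps is convolution, so this is the polynomial ring
  \<open>\<real>[x, y]\<close>.\<close>

type_synonym bipoly = "(nat \<times> nat) \<Rightarrow>\<^sub>0 real"

definition deg_le :: "bipoly \<Rightarrow> nat \<Rightarrow> bool" where
  "deg_le p k \<longleftrightarrow> (\<forall>(i, j) \<in> Poly_Mapping.keys p. i + j \<le> k)"

text \<open>The vector \<open>p(X, Y)\<close>, for \<open>deg_le p k\<close>: multiplying the moment matrix by the coefficient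
  vector of \<open>p\<close> forms the corresponding linear combination of columns.\<close>

definition col_comb :: "(nat \<Rightarrow> nat \<Rightarrow> real) \<Rightarrow> nat \<Rightarrow> bipoly \<Rightarrow> real Matrix.vec" where
  "col_comb \<beta> k p =
     moment_matrix \<beta> k *\<^sub>v
       Matrix.vec (length (monomials k)) (\<lambda>c. Poly_Mapping.lookup p (monomials k ! c))"

definition recursively_generated :: "(nat \<Rightarrow> nat \<Rightarrow> real) \<Rightarrow> nat \<Rightarrow> bool" where
  "recursively_generated \<beta> k \<longleftrightarrow>
     (\<forall>p q. deg_le p k \<and> deg_le q k \<and> deg_le (p * q) k \<and>
        col_comb \<beta> k p = 0\<^sub>v (length (monomials k)) \<longrightarrow>
        col_comb \<beta> k (p * q) = 0\<^sub>v (length (monomials k)))"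

definition monom2 :: "nat \<Rightarrow> nat \<Rightarrow> bipoly" where
  "monom2 i j = Poly_Mapping.single (i, j) 1"


subsection \<open>Representing measures\<close>

definition msupport :: "'a::topological_space measure \<Rightarrow> 'a set" where
  "msupport \<mu> = {x. \<forall>U. open U \<and> x \<in> U \<longrightarrow> emeasure \<mu> U > 0}"

definition representing_measure ::
  "(nat \<Rightarrow> nat \<Rightarrow> real) \<Rightarrow> nat \<Rightarrow> (real \<times> real) set \<Rightarrow> (real \<times> real) measure \<Rightarrow> bool" where
  "representing_measure \<beta> k K \<mu> \<longleftrightarrow>
     sets \<mu> = sets borel \<and> msupport \<mu> \<subseteq> K \<and>
     (\<forall>i j. i + j \<le> 2 * k \<longrightarrow>
        set_integrable \<mu> K (\<lambda>(x, y). x ^ i * y ^ j) \<and>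
        \<beta> i j = set_lebesgue_integral \<mu> K (\<lambda>(x, y). x ^ i * y ^ j))"

definition atomic_measure :: "nat \<Rightarrow> 'a::topological_space measure \<Rightarrow> bool" where
  "atomic_measure m \<mu> \<longleftrightarrow>
     (\<exists>S w. finite S \<and> card S = m \<and> (\<forall>s\<in>S. (w s :: real) > 0) \<and> sets \<mu> = sets borel \<and>
        (\<forall>A \<in> sets borel. emeasure \<mu> A = (\<Sum>s\<in>S. ennreal (w s) * indicator A s)))"

definition cusp_curve :: "(real \<times> real) set" where
  "cusp_curve = {(x, y). y ^ 2 = x ^ 3}"


subsection \<open>The univariate sequences attached to a bivariate multisequence\<close>

definition block :: "(nat \<Rightarrow> nat \<Rightarrow> real) \<Rightarrow> nat \<Rightarrow> real list" where
  "block \<beta> i = [\<beta> 1 i, \<beta> 0 (i + 1), \<beta> 2 i]"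

text \<open>The upper bounds of the list intervals are exclusive.\<close>

definition beta_hat :: "(nat \<Rightarrow> nat \<Rightarrow> real) \<Rightarrow> nat \<Rightarrow> real list" where
  "beta_hat \<beta> k = concat (map (block \<beta>) [0..<2 * k - 1])"

definition beta_tilde :: "(nat \<Rightarrow> nat \<Rightarrow> real) \<Rightarrow> nat \<Rightarrow> real list" where
  "beta_tilde \<beta> k = beta_hat \<beta> k @ [\<beta> 1 (2 * k - 1), \<beta> 0 (2 * k)]"

definition beta_bar :: "(nat \<Rightarrow> nat \<Rightarrow> real) \<Rightarrow> nat \<Rightarrow> real list" where
  "beta_bar \<beta> k = \<beta> 2 0 # concat (map (block \<beta>) [1..<2 * k - 1])"

definition beta_breve :: "(nat \<Rightarrow> nat \<Rightarrow> real) \<Rightarrow> nat \<Rightarrow> real list" where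
  "beta_breve \<beta> k = beta_bar \<beta> k @ [\<beta> 1 (2 * k - 1), \<beta> 0 (2 * k)]"

text \<open>For \<open>k = 1\<close> there are no blocks in the following row, which is then \<open>[\<beta> 1 0]\<close>.\<close>

definition v_row :: "(nat \<Rightarrow> nat \<Rightarrow> real) \<Rightarrow> nat \<Rightarrow> real list" where
  "v_row \<beta> k = concat (map (block \<beta>) [0..<k - 1]) @ [\<beta> 1 (k - 1)]"

definition A_tilde :: "(nat \<Rightarrow> nat \<Rightarrow> real) \<Rightarrow> nat \<Rightarrow> real mat" where
  "A_tilde \<beta> k =
     (let v = mat_of_row (vec_of_list (v_row \<beta> k)) in
      four_block_mat (Matrix.mat 1 1 (\<lambda>_. \<beta> 0 0)) v (transpose_mat v) (hankel (beta_bar \<beta> k)))"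


subsection \<open>The conditions on the multisequence\<close>

definition cond1 :: "(nat \<Rightarrow> nat \<Rightarrow> real) \<Rightarrow> nat \<Rightarrow> bool" where
  "cond1 \<beta> k \<longleftrightarrow>
     (k \<ge> 3 \<and> col_comb \<beta> k (monom2 0 2) = col_comb \<beta> k (monom2 3 0)) \<or>
     (k = 2 \<and> \<beta> 0 2 = \<beta> 3 0 \<and> \<beta> 1 2 = \<beta> 4 0 \<and> \<beta> 0 3 = \<beta> 3 1) \<or>
     k = 1"

definition cond2a :: "(nat \<Rightarrow> nat \<Rightarrow> real) \<Rightarrow> nat \<Rightarrow> bool" where
  "cond2a \<beta> k \<longleftrightarrow> pos_def (hankel (beta_tilde \<beta> k)) \<and> pos_def (A_tilde \<beta> k)"

definition cond2b :: "(nat \<Rightarrow> nat \<Rightarrow> real) \<Rightarrow> nat \<Rightarrow> bool" where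
  "cond2b \<beta> k \<longleftrightarrow>
     pos_semidef (hankel (beta_tilde \<beta> k)) \<and>
     mat_rank (hankel (beta_hat \<beta> k)) = mat_rank (hankel (beta_tilde \<beta> k)) \<and>
     mat_rank (hankel (beta_tilde \<beta> k)) = mat_rank (hankel (beta_breve \<beta> k))"

end

(* Along the parametrization t |-> (t^2, t^3) of the cusp, the moment beta_{i,j} becomes the moment
   of t^(2i+3j), so the problem is a truncated Hamburger moment problem of degree 6k in which only
   the moment of t is not prescribed.

   If the form on span{t, ..., t^(3k)} is definite, the missing moment is chosen as one of the (at
   most two) values making the full Hankel form on span{1, ..., t^(3k)} semidefinite and singular.
   Its kernel is then spanned by one polynomial p; for a suitable choice p has degree 3k, and the
   roots of p are the nodes of a Gauss quadrature with 3k atoms.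

   If that form is singular, the rank conditions say that it is flat with all atoms different from
   0; after dividing the weights by s^2 only the moment of 1 is off, and semidefiniteness of M(k),
   tested on a polynomial without linear term that vanishes at all nonzero atoms, shows that the
   defect is a nonnegative mass at the cusp.

   Conversely, for a representing measure a null vector of one of the forms vanishes almost
   everywhere and may therefore be multiplied by t, even when the degree leaves the range of the
   Hankel form. *)
theory Submission
  imports Defs "HOL-Computational_Algebra.Computational_Algebra"
begin

unbundle no vec_syntax
unbundle no fps_syntax

section \<open>Rank of a matrix and solvability of linear systems\<close>

text \<open>The exponents 2i + 3j take every natural value except 1, and f * f has no term in t as
  soon as f lacks its constant or its linear term. Every matrix in the statement is therefore a Gram
  matrix blind to the missing moment: that of \<open>beta_tilde\<close> belongs to t, ..., t^(3k),
  that of \<open>beta_hat\<close> to t, ..., t^(3k-1), that of \<open>beta_breve\<close> to t^2,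
  ..., t^(3k), \<open>A_tilde\<close> to 1, t^2, ..., t^(3k-1), and M(k) to 1, t^2, ..., t^(3k) with
  repetitions. Among the rank equalities, hat against tilde forbids an excess in the top moment, a
  mass at infinity, and breve against tilde forbids an atom at 0. In the definite case only two
  directions modulo t^2, ..., t^(3k) see the missing moment. Their 2 x 2 Gram determinant is
  quadratic in it, hence the two candidate values. Semidefiniteness of the completed form alone is
  too weak: if the kernel polynomial has degree below 3k, its roots need not reproduce the moment of
  t^(6k). Definiteness of \<open>A_tilde\<close> is what prevents this for at least one
  candidate.\<close>

lemma vec_span_image_iff:
  assumes "finite S" and b: "\<And>s. s \<in> S \<Longrightarrow> b s \<in> carrier_vec n" and v: "v \<in> carrier_vec n"
  shows "v \<in> vec_span n (b ` S) \<longleftrightarrow> (\<exists>c. \<forall>i<n. v $ i = (\<Sum>s\<in>S. c s * b s $ i))"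
proof -
  interpret vec_space "TYPE(real)" n .
  have fin: "finite (b ` S)" and car: "b ` S \<subseteq> carrier_vec n" using assms by auto
  have span: "vec_span n (b ` S) = {lincomb a (b ` S) | a. True}"
    using finite_span[OF fin car] by (simp add: vec_span_def)
  show ?thesis
  proof
    assume "v \<in> vec_span n (b ` S)"
    then obtain a where a: "v = lincomb a (b ` S)" using span by auto
    \<comment> \<open>The vectors \<open>b s\<close> may repeat, while the library speaks of sets of
      vectors. Coefficients on the set are placed on one index per vector; in the other direction
      they are summed over the fibres of \<open>b\<close>.\<close>
    obtain T where T: "T \<subseteq> S" "inj_on b T" "b ` S = b ` T"
      by (meson subset_image_inj subset_refl)
    define c where "c s = (if s \<in> T then a (b s) else 0)" for s
    have "v $ i = (\<Sum>s\<in>S. c s * b s $ i)" if "i < n" for i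
    proof -
      have "v $ i = (\<Sum>x\<in>b ` T. a x * x $ i)"
        using a T that car lincomb_index[OF that car] by simp
      also have "\<dots> = (\<Sum>s\<in>T. c s * b s $ i)"
        using T(2) by (simp add: sum.reindex c_def)
      also have "\<dots> = (\<Sum>s\<in>S. c s * b s $ i)"
        using T(1) assms(1) by (intro sum.mono_neutral_left) (auto simp: c_def)
      finally show ?thesis .
    qed
    then show "\<exists>c. \<forall>i<n. v $ i = (\<Sum>s\<in>S. c s * b s $ i)" by blast
  next
    assume "\<exists>c. \<forall>i<n. v $ i = (\<Sum>s\<in>S. c s * b s $ i)"
    then obtain c where c: "\<And>i. i < n \<Longrightarrow> v $ i = (\<Sum>s\<in>S. c s * b s $ i)" by blast
    define a where "a x = (\<Sum>s\<in>{s\<in>S. b s = x}. c s)" for x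
    have "v = lincomb a (b ` S)"
    proof (rule eq_vecI)
      show "dim_vec v = dim_vec (lincomb a (b ` S))"
        using v lincomb_dim[OF fin car] by simp
      fix i assume "i < dim_vec (lincomb a (b ` S))"
      then have i: "i < n" using lincomb_dim[OF fin car] by simp
      have "(\<Sum>s\<in>S. c s * b s $ i) = (\<Sum>x\<in>b ` S. \<Sum>s\<in>{s\<in>S. b s = x}. c s * b s $ i)"
        using assms(1) by (rule sum.image_gen)
      also have "\<dots> = (\<Sum>x\<in>b ` S. a x * x $ i)"
        unfolding a_def sum_distrib_right by (intro sum.cong) auto
      finally show "v $ i = lincomb a (b ` S) $ i"
        using c[OF i] lincomb_index[OF i car] by simp
    qed
    then show "v \<in> vec_span n (b ` S)" using span by auto
  qed
qed

text \<open>The family \<open>b\<close> is a basis of the column space. Independence also makes its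
  vectors pairwise distinct, so that counting indices is counting vectors.\<close>

lemma mat_rank_eq_card:
  assumes A: "A \<in> carrier_mat m n" and "finite S"
    and indep: "\<And>c. (\<And>i. i < m \<Longrightarrow> (\<Sum>s\<in>S. c s * b s i) = 0) \<Longrightarrow> \<forall>s\<in>S. c s = 0"
    and cols: "\<And>j. j < n \<Longrightarrow> \<exists>c. \<forall>i<m. A $$ (i, j) = (\<Sum>s\<in>S. c s * b s i)"
    and range: "\<And>s. s \<in> S \<Longrightarrow> \<exists>x. \<forall>i<m. b s i = (\<Sum>j<n. x j * A $$ (i, j))"
  shows "mat_rank A = card S"
proof -
  interpret vec_space "TYPE(real)" m .
  define B where "B s = Matrix.vec m (b s)" for s
  have Bc: "B s \<in> carrier_vec m" for s by (simp add: B_def)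
  have B_index: "B s $ i = b s i" if "i < m" for s i using that by (simp add: B_def)
  have inj: "inj_on B S"
  proof (rule inj_onI, rule ccontr)
    fix s t assume st: "s \<in> S" "t \<in> S" "B s = B t" "s \<noteq> t"
    define c where "c u = (if u = s then 1 else if u = t then -1 else (0::real))" for u
    have "(\<Sum>u\<in>S. c u * b u i) = 0" if "i < m" for i
    proof -
      have "(\<Sum>u\<in>S. c u * b u i) = (\<Sum>u\<in>{s, t}. c u * b u i)"
        using st assms(2) by (intro sum.mono_neutral_right) (auto simp: c_def)
      also have "\<dots> = b s i - b t i" using st by (simp add: c_def)
      also have "\<dots> = 0" using st(3) B_index[OF that] by (metis diff_self)
      finally show ?thesis .
    qed
    from indep[OF this] have "c s = 0" using st by blast
    then show False by (simp add: c_def)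
  qed
  have car: "B ` S \<subseteq> carrier_vec m" and fin: "finite (B ` S)" using Bc assms(2) by auto
  have key: "\<forall>v\<in>B ` S. a v = 0" if lc: "lincomb a (B ` S) = 0\<^sub>v m" for a
  proof -
    have "\<forall>s\<in>S. a (B s) = 0"
    proof (rule indep)
      fix i assume i: "i < m"
      have "(\<Sum>s\<in>S. a (B s) * b s i) = (\<Sum>x\<in>B ` S. a x * x $ i)"
        using inj i by (simp add: sum.reindex B_index)
      also have "\<dots> = lincomb a (B ` S) $ i" using lincomb_index[OF i car] by simp
      also have "\<dots> = 0" using lc i by simp
      finally show "(\<Sum>s\<in>S. a (B s) * b s i) = 0" .
    qed
    then show ?thesis by blast
  qed
  have li: "lin_indpt (B ` S)"
    using key car by (intro finite_lin_indpt2[OF fin]) auto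
  have carA: "set (cols A) \<subseteq> carrier_vec m" using A cols_dim by blast
  have cols_eq: "set (cols A) = col A ` {..<n}" using A by (auto simp: cols_def)
  have "span (set (cols A)) = span (B ` S)"
  proof
    show "span (set (cols A)) \<subseteq> span (B ` S)"
    proof (rule span_subsetI[OF car], rule subsetI)
      fix v assume "v \<in> set (cols A)"
      then obtain j where j: "j < n" "v = col A j" using cols_eq by auto
      have "v \<in> vec_span m (B ` S)"
      proof (subst vec_span_image_iff[OF assms(2) Bc])
        show "v \<in> carrier_vec m" using j A by simp
        show "\<exists>c. \<forall>i<m. v $ i = (\<Sum>s\<in>S. c s * B s $ i)"
          using cols[OF j(1)] j A by (simp add: B_index)
      qed
      then show "v \<in> span (B ` S)" by (simp add: vec_span_def)
    qed
    show "span (B ` S) \<subseteq> span (set (cols A))"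
    proof (rule span_subsetI[OF carA], rule subsetI)
      fix v assume "v \<in> B ` S"
      then obtain s where s: "s \<in> S" "v = B s" by auto
      have "v \<in> vec_span m (col A ` {..<n})"
      proof (subst vec_span_image_iff)
        show "finite {..<n}" "v \<in> carrier_vec m" using s Bc by simp_all
        show "col A j \<in> carrier_vec m" for j by (rule carrier_vecI) (use A in simp)
        show "\<exists>c. \<forall>i<m. v $ i = (\<Sum>j<n. c j * col A j $ i)"
          using range[OF s(1)] s(2) A by (simp add: B_index)
      qed
      then show "v \<in> span (set (cols A))" by (simp add: vec_span_def cols_eq)
    qed
  qed
  then have "rank A = vectorspace.dim class_ring (span_vs (B ` S))" by (simp add: rank_def)
  also have "\<dots> = card (B ` S)"
  proof (rule dim_span)
    show "B ` S \<subseteq> carrier_vec m" "finite (B ` S)" using car fin by auto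
    show "maximal (B ` S) (\<lambda>T. T \<subseteq> B ` S \<and> lin_indpt T)" using li by (auto simp: maximal_def)
  qed
  also have "\<dots> = card S" using inj by (rule card_image)
  finally show ?thesis using A by (simp add: mat_rank_def)
qed

text \<open>Here \<open>A\<close> factors as B^T D B, where B has the rows \<open>b s\<close> and D
  is the diagonal of weights. The vectors from \<open>separate\<close> form a right inverse of B:
  they force the \<open>b s\<close> to be independent, and divided by \<open>w s\<close> they are
  mapped by \<open>A\<close> to \<open>b s\<close>. Weights of either sign are allowed.\<close>

lemma mat_rank_sum_atoms:
  assumes A: "A \<in> carrier_mat n n" and "finite S"
    and w: "\<And>s. s \<in> S \<Longrightarrow> w s \<noteq> 0"
    and entry: "\<And>i j. i < n \<Longrightarrow> j < n \<Longrightarrow> A $$ (i, j) = (\<Sum>s\<in>S. w s * b s i * b s j)"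
    and separate: "\<And>s. s \<in> S \<Longrightarrow> \<exists>x. \<forall>t\<in>S. (\<Sum>j<n. x j * b t j) = (if t = s then 1 else 0)"
  shows "mat_rank A = card S"
proof (rule mat_rank_eq_card[OF A assms(2), where b = b])
  fix c assume c: "\<And>i. i < n \<Longrightarrow> (\<Sum>s\<in>S. c s * b s i) = 0"
  show "\<forall>s\<in>S. c s = 0"
  proof
    fix s assume s: "s \<in> S"
    obtain x where x: "\<forall>t\<in>S. (\<Sum>j<n. x j * b t j) = (if t = s then 1 else 0)"
      using separate[OF s] by (rule exE)
    have "0 = (\<Sum>j<n. x j * (\<Sum>t\<in>S. c t * b t j))" using c by simp
    also have "\<dots> = (\<Sum>t\<in>S. \<Sum>j<n. x j * (c t * b t j))"
      unfolding sum_distrib_left by (rule sum.swap)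
    also have "\<dots> = (\<Sum>t\<in>S. c t * (\<Sum>j<n. x j * b t j))"
      by (simp add: sum_distrib_left mult.left_commute)
    also have "\<dots> = (\<Sum>t\<in>S. if t = s then c t else 0)"
      by (rule sum.cong) (simp_all add: bspec[OF x])
    also have "\<dots> = c s" using s assms(2) by simp
    finally show "c s = 0" by simp
  qed
next
  fix j assume j: "j < n"
  show "\<exists>c. \<forall>i<n. A $$ (i, j) = (\<Sum>s\<in>S. c s * b s i)"
    using j by (intro exI[of _ "\<lambda>s. w s * b s j"]) (simp add: entry ac_simps)
next
  fix s assume s: "s \<in> S"
  obtain x where x: "\<forall>t\<in>S. (\<Sum>j<n. x j * b t j) = (if t = s then 1 else 0)"
    using separate[OF s] by (rule exE)
  have "b s i = (\<Sum>j<n. (x j / w s) * A $$ (i, j))" if i: "i < n" for i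
  proof -
    have "(\<Sum>j<n. (x j / w s) * A $$ (i, j)) = (\<Sum>j<n. \<Sum>t\<in>S. (x j / w s) * (w t * b t i * b t j))"
      using i by (simp add: entry sum_distrib_left)
    also have "\<dots> = (\<Sum>t\<in>S. \<Sum>j<n. (x j / w s) * (w t * b t i * b t j))" by (rule sum.swap)
    also have "\<dots> = (\<Sum>t\<in>S. w t * b t i / w s * (\<Sum>j<n. x j * b t j))"
      unfolding sum_distrib_left by (simp add: field_simps)
    also have "\<dots> = (\<Sum>t\<in>S. if t = s then b t i else 0)"
      using w[OF s] by (intro sum.cong) (simp_all add: bspec[OF x])
    also have "\<dots> = b s i" using s assms(2) by simp
    finally show ?thesis by simp
  qed
  then show "\<exists>x. \<forall>i<n. b s i = (\<Sum>j<n. x j * A $$ (i, j))"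
    by (intro exI[of _ "\<lambda>j. x j / w s"]) simp
qed

lemma solvable_of_trivial_kernel:
  fixes a :: "nat \<Rightarrow> nat \<Rightarrow> real"
  assumes "\<And>x. (\<And>i. i < n \<Longrightarrow> (\<Sum>j<n. a i j * x j) = 0) \<Longrightarrow> \<forall>j<n. x j = 0"
  shows "\<exists>x. \<forall>i<n. (\<Sum>j<n. a i j * x j) = y i"
    and "invertible_mat (Matrix.mat n n (\<lambda>(i, j). a i j))"
proof -
  define A where "A = Matrix.mat n n (\<lambda>(i, j). a i j)"
  have A: "A \<in> carrier_mat n n" by (simp add: A_def)
  have mv: "(A *\<^sub>v Matrix.vec n x) $ i = (\<Sum>j<n. a i j * x j)" if "i < n" for x i
    using that by (simp add: A_def scalar_prod_def atLeast0LessThan)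
  have "Determinant.det A \<noteq> 0"
  proof
    assume "Determinant.det A = 0"
    then obtain v where v: "v \<in> carrier_vec n" "v \<noteq> 0\<^sub>v n" "A *\<^sub>v v = 0\<^sub>v n"
      using det_0_iff_vec_prod_zero_field[OF A] by auto
    have "\<forall>j<n. v $ j = 0"
    proof (rule assms)
      fix i assume "i < n"
      have "Matrix.vec n (($) v) = v" using v(1) by auto
      then show "(\<Sum>j<n. a i j * v $ j) = 0" using mv[OF \<open>i < n\<close>, of "($) v"] v \<open>i < n\<close> by simp
    qed
    then show False using v by auto
  qed
  from det_non_zero_imp_unit[OF A this, of "()"]
  obtain B where B: "B \<in> carrier_mat n n" "A * B = 1\<^sub>m n" "B * A = 1\<^sub>m n"
    unfolding Units_def ring_mat_def by auto
  then show "invertible_mat (Matrix.mat n n (\<lambda>(i, j). a i j))"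
    unfolding A_def[symmetric] invertible_mat_def inverts_mat_def using A by (auto intro!: exI[of _ B])
  define v where "v = B *\<^sub>v Matrix.vec n y"
  have v: "v \<in> carrier_vec n" using B by (simp add: v_def)
  have "A *\<^sub>v v = Matrix.vec n y"
    unfolding v_def using A B by (subst assoc_mult_mat_vec[symmetric, of _ n n]) auto
  moreover have "Matrix.vec n (($) v) = v" using v by auto
  ultimately have "(\<Sum>j<n. a i j * v $ j) = y i" if "i < n" for i
    using mv[OF that, of "($) v"] that by simp
  then show "\<exists>x. \<forall>i<n. (\<Sum>j<n. a i j * x j) = y i"
    by (intro exI[of _ "($) v"]) simp
qed

lemma not_invertible_matI:
  fixes a :: "nat \<Rightarrow> nat \<Rightarrow> real"
  assumes "\<And>i. i < n \<Longrightarrow> (\<Sum>j<n. a i j * x j) = 0" and "j < n" and "x j \<noteq> 0"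
  shows "\<not> invertible_mat (Matrix.mat n n (\<lambda>(i, j). a i j))"
proof
  let ?A = "Matrix.mat n n (\<lambda>(i, j). a i j)" and ?v = "Matrix.vec n x"
  assume "invertible_mat ?A"
  then obtain B where B: "inverts_mat ?A B" "inverts_mat B ?A" unfolding invertible_mat_def by blast
  have B_dim: "dim_row B = n" "dim_col B = n"
    using arg_cong[OF B(1)[unfolded inverts_mat_def], of dim_col]
      arg_cong[OF B(2)[unfolded inverts_mat_def], of dim_col] by auto
  have "?A *\<^sub>v ?v = 0\<^sub>v n"
    using assms(1) by (intro eq_vecI) (auto simp: scalar_prod_def atLeast0LessThan)
  then have "B *\<^sub>v (?A *\<^sub>v ?v) = 0\<^sub>v n" using B_dim
    by (intro eq_vecI) (auto simp: scalar_prod_def)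
  moreover have "B *\<^sub>v (?A *\<^sub>v ?v) = ?v"
    using B_dim B(2) by (subst assoc_mult_mat_vec[symmetric, of _ n n]) (auto simp: inverts_mat_def)
  ultimately show False using assms(2,3) by (metis index_vec index_zero_vec(1))
qed

section \<open>Riesz functionals and Gauss quadrature\<close>

text \<open>The linear functional sending t^i to \<open>g i\<close>. Since the sum stops at the
  degree, an infinite sequence can stand for a truncated one: \<open>g i\<close> matters only where
  the coefficient of t^i is nonzero.\<close>

definition riesz :: "(nat \<Rightarrow> real) \<Rightarrow> real poly \<Rightarrow> real" where
  "riesz g p = (\<Sum>i\<le>degree p. coeff p i * g i)"

lemma riesz_altdef:
  assumes "degree p \<le> N"
  shows "riesz g p = (\<Sum>i\<le>N. coeff p i * g i)"
  unfolding riesz_def using assms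
  by (intro sum.mono_neutral_left) (auto simp: coeff_eq_0)

lemma riesz_0 [simp]: "riesz g 0 = 0"
  by (simp add: riesz_def)

lemma riesz_add: "riesz g (p + q) = riesz g p + riesz g q"
proof -
  let ?N = "max (degree p) (degree q)"
  have "degree (p + q) \<le> ?N" by (rule degree_add_le_max)
  then show ?thesis
    by (simp add: riesz_altdef[of _ ?N] algebra_simps sum.distrib)
qed

lemma riesz_smult: "riesz g (Polynomial.smult c p) = c * riesz g p"
  using degree_smult_le[of c p]
  by (simp add: riesz_altdef[of _ "degree p"] sum_distrib_left mult.assoc)

lemma riesz_diff: "riesz g (p - q) = riesz g p - riesz g q"
  using riesz_add[of g "p - q" q] by simp

lemma riesz_sum: "riesz g (\<Sum>x\<in>A. f x) = (\<Sum>x\<in>A. riesz g (f x))"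
  by (induction A rule: infinite_finite_induct) (simp_all add: riesz_add)

lemma riesz_monom: "riesz g (monom c i) = c * g i"
  by (simp add: riesz_altdef[OF degree_monom_le] if_distrib[of "\<lambda>x. x * _"] cong: if_cong)

lemma riesz_cong:
  assumes "\<And>i. i \<le> degree p \<Longrightarrow> coeff p i \<noteq> 0 \<Longrightarrow> g i = h i"
  shows "riesz g p = riesz h p"
  unfolding riesz_def using assms by (intro sum.cong) auto

lemma poly_as_sum_monoms_le:
  assumes "degree p \<le> N"
  shows "p = (\<Sum>i\<le>N. monom (coeff p i) i)"
  by (rule poly_as_sum_of_monoms'[OF assms, symmetric])

lemma riesz_mult_expand:
  assumes "degree h \<le> N"
  shows "riesz g (p * h) = (\<Sum>j\<le>N. coeff h j * riesz g (p * monom 1 j))"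
proof -
  have "p * h = p * (\<Sum>j\<le>N. monom (coeff h j) j)" using poly_as_sum_monoms_le[OF assms] by simp
  also have "\<dots> = (\<Sum>j\<le>N. Polynomial.smult (coeff h j) (p * monom 1 j))"
    by (simp add: sum_distrib_left smult_monom flip: mult_smult_right)
  finally show ?thesis by (simp add: riesz_sum riesz_smult)
qed

lemma riesz_mult_eq_0:
  assumes "\<And>j. j \<le> N \<Longrightarrow> riesz g (p * monom 1 j) = 0" and "degree h \<le> N"
  shows "riesz g (p * h) = 0"
  using assms by (simp add: riesz_mult_expand)

lemma riesz_mult_monom: "riesz g (p * monom 1 j) = (\<Sum>i\<le>degree p. coeff p i * g (i + j))"
proof -
  have "riesz g (p * monom 1 j) = riesz g (monom 1 j * p)" by (simp add: mult.commute)
  also have "\<dots> = (\<Sum>i\<le>degree p. coeff p i * riesz g (monom 1 j * monom 1 i))"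
    by (rule riesz_mult_expand) simp
  finally show ?thesis by (simp add: mult_monom riesz_monom add.commute)
qed

lemma riesz_shift: "riesz g (p * monom 1 d) = riesz (\<lambda>i. g (i + d)) p"
  by (subst riesz_mult_monom) (simp add: riesz_def)

lemma riesz_atoms:
  assumes "\<And>m. m \<le> M \<Longrightarrow> g m = (\<Sum>s\<in>S. w s * s ^ m)" and "degree p \<le> M"
  shows "riesz g p = (\<Sum>s\<in>S. w s * poly p s)"
proof -
  have "riesz g p = (\<Sum>i\<le>M. coeff p i * (\<Sum>s\<in>S. w s * s ^ i))"
    using assms by (simp add: riesz_altdef)
  also have "\<dots> = (\<Sum>i\<le>M. \<Sum>s\<in>S. w s * (coeff p i * s ^ i))"
    by (simp add: sum_distrib_left mult.left_commute)
  also have "\<dots> = (\<Sum>s\<in>S. \<Sum>i\<le>M. w s * (coeff p i * s ^ i))" by (rule sum.swap)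
  also have "\<dots> = (\<Sum>s\<in>S. w s * poly p s)"
    using assms(2)
    by (simp add: sum_distrib_left poly_altdef riesz_altdef[of p M "\<lambda>i. _ ^ i", unfolded riesz_def])
  finally show ?thesis .
qed

text \<open>A null vector of a semidefinite form lies in its radical: otherwise the form, which is
  affine in c on c f + h, would take negative values.\<close>

lemma riesz_kernel:
  assumes psd: "\<And>f. degree f \<le> N \<Longrightarrow> riesz g (f * f) \<ge> 0"
    and f: "degree f \<le> N" "riesz g (f * f) = 0" and h: "degree h \<le> N"
  shows "riesz g (f * h) = 0"
proof (rule ccontr)
  assume ne: "riesz g (f * h) \<noteq> 0"
  \<comment> \<open>Chosen so that the square of c f + h has the value -1.\<close>
  define c where "c = - (riesz g (h * h) + 1) / (2 * riesz g (f * h))"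
  have "degree (Polynomial.smult c f + h) \<le> N"
    using f(1) h degree_smult_le[of c f] by (intro degree_add_le) auto
  then have "0 \<le> riesz g ((Polynomial.smult c f + h) * (Polynomial.smult c f + h))" by (rule psd)
  also have "(Polynomial.smult c f + h) * (Polynomial.smult c f + h) =
      Polynomial.smult (c * c) (f * f) + (Polynomial.smult c (f * h) + Polynomial.smult c (f * h)) + h * h"
    by (simp add: distrib_left distrib_right mult.commute)
  also have "riesz g \<dots> = 2 * c * riesz g (f * h) + riesz g (h * h)"
    unfolding riesz_add riesz_smult f(2) by simp
  also have "\<dots> = -1" using ne by (simp add: c_def field_simps)
  finally show False by simp
qed

section \<open>Lagrange interpolation\<close>

definition lagrange :: "real set \<Rightarrow> real \<Rightarrow> real poly" where
  "lagrange S s = Polynomial.smult (1 / (\<Prod>t\<in>S - {s}. s - t)) (\<Prod>t\<in>S - {s}. [:- t, 1:])"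

lemma degree_lagrange:
  assumes "finite S" "s \<in> S"
  shows "degree (lagrange S s) < card S"
proof -
  have "degree (\<Prod>t\<in>S - {s}. [:- t, 1:]) \<le> (\<Sum>t\<in>S - {s}. degree [:- t, 1:])"
    using degree_prod_sum_le[of "S - {s}" "\<lambda>t. [:- t, 1:]"] assms(1) by (simp add: comp_def)
  also have "\<dots> = card (S - {s})" by simp
  also have "\<dots> < card S" using assms by (rule card_Diff1_less)
  finally show ?thesis unfolding lagrange_def by (rule le_less_trans[OF degree_smult_le])
qed

lemma poly_lagrange:
  assumes "finite S" "s \<in> S" "t \<in> S"
  shows "poly (lagrange S s) t = (if t = s then 1 else 0)"
  using assms by (auto simp: lagrange_def poly_prod prod_zero_iff)

lemma eq_sum_lagrange:
  assumes "finite S" "degree p < card S"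
  shows "p = (\<Sum>s\<in>S. Polynomial.smult (poly p s) (lagrange S s))"
proof (rule poly_eqI_degree[of S])
  show "poly p t = poly (\<Sum>s\<in>S. Polynomial.smult (poly p s) (lagrange S s)) t" if "t \<in> S" for t
    using assms(1) that by (simp add: poly_sum poly_lagrange if_distrib cong: if_cong)
  show "card S > degree p" by fact
  have "degree (\<Sum>s\<in>S. Polynomial.smult (poly p s) (lagrange S s)) \<le> card S - 1"
    using assms(1) degree_lagrange[OF assms(1)]
    by (intro degree_sum_le order.trans[OF degree_smult_le]) fastforce+
  then show "card S > degree (\<Sum>s\<in>S. Polynomial.smult (poly p s) (lagrange S s))"
    using assms(2) by simp
qed

section \<open>Real polynomials all of whose roots are real and simple\<close>

lemma map_poly_of_real_add:
  "map_poly complex_of_real (p + q) = map_poly complex_of_real p + map_poly complex_of_real q"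
  by (rule poly_eqI) (simp add: coeff_map_poly)

lemma map_poly_of_real_mult:
  "map_poly complex_of_real (p * q) = map_poly complex_of_real p * map_poly complex_of_real q"
  by (rule poly_eqI) (simp add: coeff_map_poly coeff_mult)

lemma poly_map_poly_of_real: "poly (map_poly complex_of_real p) (of_real u) = of_real (poly p u)"
  by (induction p) (simp_all add: map_poly_pCons)

lemma degree_div_add_degree:
  fixes p h :: "real poly"
  assumes "p \<noteq> 0" "h div p \<noteq> 0"
  shows "degree (h div p) + degree p = degree h"
proof -
  have deg: "degree (p * (h div p)) = degree p + degree (h div p)"
    using assms by (rule degree_mult_eq)
  have h: "h = p * (h div p) + h mod p" by simp
  show ?thesis
  proof (cases "h mod p = 0")
    case True
    then show ?thesis using deg h by simp
  next
    case False
    then have "degree (h mod p) < degree (p * (h div p))"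
      using degree_mod_less'[OF assms(1) False] deg by simp
    then show ?thesis using deg h degree_add_eq_left by (metis add.commute)
  qed
qed

text \<open>The forbidden factor is (t - u)^2 + v^2. It stands for a pair of non-real roots if v is
  nonzero and for a double real root if v = 0, so its absence leaves only simple real roots.\<close>

lemma card_roots_eq_degree:
  fixes p :: "real poly"
  assumes "p \<noteq> 0" and "\<And>u v q. p \<noteq> [:u\<^sup>2 + v\<^sup>2, - 2 * u, 1:] * q"
  shows "card {s. poly p s = 0} = degree p"
  using assms
proof (induction "degree p" arbitrary: p)
  case 0
  then obtain c where "p = [:c:]" using degree_eq_zeroE by metis
  then show ?case using 0 by simp
next
  case (Suc d)
  let ?P = "map_poly complex_of_real p"
  have "degree ?P \<noteq> 0" using Suc.hyps(2) by (simp add: degree_map_poly)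
  then have "\<not> constant (poly ?P)" by (simp add: constant_degree)
  then obtain z where z: "poly ?P z = 0" using fundamental_theorem_of_algebra by blast
  define u v where "u = Re z" and "v = Im z"
  let ?Q = "[:u\<^sup>2 + v\<^sup>2, - 2 * u, 1:]"
  have "v = 0"
  proof (rule ccontr)
    assume v: "v \<noteq> 0"
    \<comment> \<open>For nonzero v, \<open>?Q\<close> is the real minimal polynomial of z. The
      remainder is linear with real coefficients and vanishes at the non-real z, hence it is
      zero.\<close>
    define \<rho> where "\<rho> = p mod ?Q"
    have "degree \<rho> \<le> 1"
      using degree_mod_less'[of ?Q p] by (cases "\<rho> = 0") (auto simp: \<rho>_def)
    define a b where "a = coeff \<rho> 0" and "b = coeff \<rho> 1"
    have ab: "\<rho> = [:a, b:]"
      using \<open>degree \<rho> \<le> 1\<close>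
      by (auto simp: poly_eq_iff coeff_pCons a_def b_def coeff_eq_0 split: nat.split)
    have "poly (map_poly complex_of_real ?Q) z = 0"
      by (simp add: map_poly_pCons complex_eq_iff u_def v_def power2_eq_square algebra_simps)
    moreover have "?P = map_poly complex_of_real ?Q * map_poly complex_of_real (p div ?Q)
        + map_poly complex_of_real \<rho>"
    proof -
      have "p = ?Q * (p div ?Q) + \<rho>" by (simp only: \<rho>_def mult_div_mod_eq)
      then show ?thesis
        by (metis map_poly_of_real_add map_poly_of_real_mult)
    qed
    ultimately have "poly (map_poly complex_of_real \<rho>) z = 0" using z by simp
    then have "of_real a + z * of_real b = 0" by (simp add: ab map_poly_pCons)
    then have "b = 0" "a = 0" using v by (auto simp: complex_eq_iff v_def)
    then have "p = ?Q * (p div ?Q)" using ab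
      by (metis \<rho>_def div_mult_mod_eq add.right_neutral mult.commute pCons_0_0)
    then show False using Suc.prems(2) by blast
  qed
  then have "z = of_real u" by (simp add: complex_eq_iff u_def v_def)
  then have "poly p u = 0" using z by (simp add: poly_map_poly_of_real)
  then obtain q where q: "p = [:- u, 1:] * q" using poly_eq_0_iff_dvd by blast
  have q0: "q \<noteq> 0" using q Suc.prems by auto
  have deg: "degree p = Suc (degree q)" unfolding q using q0 by (subst degree_mult_eq) auto
  have "card {s. poly q s = 0} = degree q"
  proof (rule Suc.hyps(1))
    show "d = degree q" using deg Suc.hyps(2) by simp
    show "q \<noteq> [:a\<^sup>2 + b\<^sup>2, - 2 * a, 1:] * q'" for a b q'
      using Suc.prems(2)[of a b "[:- u, 1:] * q'"] q by (metis mult.left_commute)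
  qed (fact q0)
  moreover have "poly q u \<noteq> 0"
  proof
    assume "poly q u = 0"
    then obtain q' where "q = [:- u, 1:] * q'" using poly_eq_0_iff_dvd by blast
    then have "p = [:- u, 1:] * [:- u, 1:] * q'" using q by (simp only: mult.assoc)
    also have "[:- u, 1:] * [:- u, 1:] = [:u\<^sup>2 + 0\<^sup>2, - 2 * u, 1:]" by (simp add: power2_eq_square)
    finally have "p = [:u\<^sup>2 + 0\<^sup>2, - 2 * u, 1:] * q'" .
    then show False using Suc.prems(2) by blast
  qed
  moreover have "{s. poly p s = 0} = insert u {s. poly q s = 0}" unfolding q by auto
  ultimately show ?case using deg poly_roots_finite[OF q0] by simp
qed

text \<open>Dividing by \<open>p\<close> reduces every \<open>h\<close> to its remainder, and
  interpolation at the roots of \<open>p\<close> integrates the remainder exactly. The bound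
  \<open>2 * r \<le> M + 2\<close> keeps squares of polynomials of degree at most r - 1 within the
  exact range; this serves both the simplicity of the roots and the positivity of the weights, each
  weight being the value at a squared Lagrange polynomial.\<close>

lemma gauss_quadrature:
  assumes p: "p \<noteq> 0" "degree p = r"
    and pos: "\<And>q. q \<noteq> 0 \<Longrightarrow> degree q < r \<Longrightarrow> riesz g (q * q) > 0"
    and orth: "\<And>h. degree h + r \<le> M \<Longrightarrow> riesz g (p * h) = 0"
    and M: "2 * r \<le> M + 2"
  obtains S w where "finite S" "card S = r" "\<And>s. s \<in> S \<Longrightarrow> w s > 0"
    "\<And>h. degree h \<le> M \<Longrightarrow> riesz g h = (\<Sum>s\<in>S. w s * poly h s)"
proof -
  define S where "S = {s. poly p s = 0}"
  define w where "w s = riesz g (lagrange S s)" for s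
  have fin: "finite S" unfolding S_def using p poly_roots_finite by blast
  have card: "card S = r"
    unfolding S_def p(2)[symmetric]
  proof (rule card_roots_eq_degree[OF p(1)], rule notI)
    fix u v q assume pq: "p = [:u\<^sup>2 + v\<^sup>2, - 2 * u, 1:] * q"
    txt \<open>A double or non-real root \<open>u + i v\<close> of \<open>p\<close> would make \<open>p * q\<close> a sum of squares of degree below
      \<open>2 * r\<close>, although \<open>p\<close> is orthogonal to \<open>q\<close>.\<close>
    have q0: "q \<noteq> 0" using pq p by auto
    have deg: "r = degree q + 2" using p(2) unfolding pq using q0 by (subst (asm) degree_mult_eq) auto
    have "p * q = ([:- u, 1:] * q) * ([:- u, 1:] * q) + Polynomial.smult (v\<^sup>2) (q * q)"
    proof -
      have "[:u\<^sup>2 + v\<^sup>2, - 2 * u, 1:] = [:- u, 1:] * [:- u, 1:] + [:v\<^sup>2:]"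
        by (simp add: power2_eq_square)
      then have "p * q = ([:- u, 1:] * [:- u, 1:] + [:v\<^sup>2:]) * q * q" using pq by simp
      also have "\<dots> = ([:- u, 1:] * q) * ([:- u, 1:] * q) + [:v\<^sup>2:] * (q * q)"
        by (simp only: distrib_right distrib_left mult.assoc mult.left_commute mult.commute)
      finally show ?thesis by simp
    qed
    then have "riesz g (([:- u, 1:] * q) * ([:- u, 1:] * q)) + v\<^sup>2 * riesz g (q * q) = 0"
      using orth[of q] M deg by (simp add: riesz_add riesz_smult)
    moreover have "riesz g (([:- u, 1:] * q) * ([:- u, 1:] * q)) > 0"
    proof (rule pos)
      show "[:- u, 1:] * q \<noteq> 0" using q0 by (simp only: mult_eq_0_iff) simp
      have "degree ([:- u, 1:] * q) = Suc (degree q)" using q0 by (subst degree_mult_eq) auto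
      then show "degree ([:- u, 1:] * q) < r" using deg by simp
    qed
    moreover have "v\<^sup>2 * riesz g (q * q) \<ge> 0" using pos[OF q0] deg by simp
    ultimately show False by linarith
  qed
  have quad: "riesz g h = (\<Sum>s\<in>S. w s * poly h s)" if h: "degree h \<le> M" for h
  proof -
    define q \<rho> where "q = h div p" and "\<rho> = h mod p"
    have split: "h = p * q + \<rho>" by (simp add: q_def \<rho>_def)
    have "riesz g (p * q) = 0"
    proof (cases "q = 0")
      case False
      then have "degree q + r \<le> M"
        using h p degree_div_add_degree[of p h] unfolding q_def by simp
      then show ?thesis by (rule orth)
    qed simp
    then have eq: "riesz g h = riesz g \<rho>" using split by (simp add: riesz_add)
    show ?thesis
    \<comment> \<open>The zero polynomial has degree 0, so for r = 0 the remainder does not satisfy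
      the strict degree bound that interpolation asks for.\<close>
    proof (cases "r = 0")
      case True
      then have "\<rho> = 0" using p unfolding \<rho>_def
        by (metis degree_mod_less' less_nat_zero_code)
      moreover have "S = {}" using card fin True by simp
      ultimately show ?thesis using eq by simp
    next
      case False
      then have "degree \<rho> < card S" using card p unfolding \<rho>_def
        by (metis degree_0 degree_mod_less' neq0_conv)
      from eq_sum_lagrange[OF fin this]
      have "riesz g \<rho> = (\<Sum>s\<in>S. poly \<rho> s * w s)"
        unfolding w_def by (metis (no_types, lifting) riesz_smult riesz_sum sum.cong)
      also have "\<dots> = (\<Sum>s\<in>S. w s * poly h s)"
        unfolding split by (intro sum.cong) (auto simp: S_def)
      finally show ?thesis using eq by simp
    qed
  qed
  have "w s > 0" if s: "s \<in> S" for s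
  proof -
    let ?l = "lagrange S s"
    have d: "degree ?l < r" using degree_lagrange[OF fin s] card by simp
    have "?l \<noteq> 0" using poly_lagrange[OF fin s s] by auto
    then have "0 < riesz g (?l * ?l)" using d by (rule pos)
    also have "\<dots> = (\<Sum>t\<in>S. w t * poly (?l * ?l) t)"
      using degree_mult_le[of ?l ?l] d M by (intro quad) simp
    also have "\<dots> = (\<Sum>t\<in>S. if t = s then w t else 0)"
      using poly_lagrange[OF fin s] by (intro sum.cong) auto
    also have "\<dots> = w s" using fin s by simp
    finally show ?thesis .
  qed
  then show ?thesis using that[OF fin card _ quad] by blast
qed

section \<open>Flat Hankel forms\<close>

text \<open>\<open>N\<close> counts rows, so this is the form on polynomials of degree below
  \<open>N\<close>; degree at most \<open>N\<close> corresponds to \<open>Suc N\<close>.\<close>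

abbreviation hankel_form :: "nat \<Rightarrow> (nat \<Rightarrow> real) \<Rightarrow> real mat" where
  "hankel_form N g \<equiv> Matrix.mat N N (\<lambda>(i, j). g (i + j))"

text \<open>The coefficients of the Lagrange polynomials separate the atoms. They fit into N entries
  because their degree is below \<open>card S\<close>, which is at most \<open>N\<close>.\<close>

lemma mat_rank_hankel_form_atoms:
  assumes "finite S" "card S \<le> N" and w: "\<And>s. s \<in> S \<Longrightarrow> w s \<noteq> 0"
    and g: "\<And>m. m + 2 \<le> 2 * N \<Longrightarrow> g m = (\<Sum>s\<in>S. w s * s ^ m)"
  shows "mat_rank (hankel_form N g) = card S"
proof (rule mat_rank_sum_atoms[where w = w and b = "\<lambda>s i. s ^ i"])
  show "hankel_form N g \<in> carrier_mat N N" by simp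
  show "hankel_form N g $$ (i, j) = (\<Sum>s\<in>S. w s * s ^ i * s ^ j)" if "i < N" "j < N" for i j
    using that g[of "i + j"] by (simp add: power_add mult.assoc)
  show "\<exists>x. \<forall>t\<in>S. (\<Sum>j<N. x j * t ^ j) = (if t = s then 1 else 0)" if s: "s \<in> S" for s
  proof (intro exI ballI)
    fix t assume t: "t \<in> S"
    have "degree (lagrange S s) \<le> N - 1" and N: "N > 0"
      using degree_lagrange[OF assms(1) s] assms(2) by auto
    then have "(\<Sum>j\<le>N - 1. coeff (lagrange S s) j * t ^ j) = poly (lagrange S s) t"
      using riesz_altdef[of "lagrange S s" "N - 1" "\<lambda>j. t ^ j"] by (simp add: riesz_def poly_altdef)
    moreover have "{..N - 1} = {..<N}" using N by auto
    ultimately show "(\<Sum>j<N. coeff (lagrange S s) j * t ^ j) = (if t = s then 1 else 0)"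
      using poly_lagrange[OF assms(1) s t] by simp
  qed
qed (use assms in auto)

lemma degree_sum_monom_less:
  assumes "r > 0"
  shows "degree (\<Sum>s<r. monom (c s) s) < r"
proof -
  have "degree (\<Sum>s<r. monom (c s) s) \<le> r - 1"
    by (intro degree_sum_le) (auto intro: order.trans[OF degree_monom_le])
  then show ?thesis using assms by simp
qed

lemma coeff_sum_monom: "coeff (\<Sum>s<r. monom (c s) s) i = (if i < r then c i else 0)"
  by (simp add: coeff_sum if_distrib cong: if_cong)

lemma riesz_sum_monom_mult:
  "riesz g ((\<Sum>s\<in>S. monom (c s) s) * monom 1 i) = (\<Sum>s\<in>S. c s * g (i + s))"
  by (simp add: sum_distrib_right mult_monom riesz_sum riesz_monom add.commute)

text \<open>A relation among the columns is a polynomial of degree below \<open>r\<close> orthogonal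
  to all such polynomials, in particular to itself.\<close>

lemma hankel_columns_independent:
  assumes def: "\<And>q. q \<noteq> 0 \<Longrightarrow> degree q < r \<Longrightarrow> riesz g (q * q) \<noteq> 0"
    and c: "\<And>i. i < r \<Longrightarrow> (\<Sum>s<r. c s * g (i + s)) = 0"
  shows "\<forall>s<r. c s = 0"
proof (cases "r = 0")
  case False
  define q where "q = (\<Sum>s<r. monom (c s) s)"
  have dq: "degree q < r" unfolding q_def using False by (intro degree_sum_monom_less) simp
  have "riesz g (q * q) = 0"
  proof (rule riesz_mult_eq_0[of "r - 1"])
    fix j assume "j \<le> r - 1"
    then show "riesz g (q * monom 1 j) = 0"
      unfolding q_def riesz_sum_monom_mult using c[of j] False by simp
  qed (use dq in simp)
  then have "q = 0" using def dq by blast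
  then show ?thesis using coeff_sum_monom[of c r] by (metis coeff_0 q_def)
qed simp

lemma sum_unit_left:
  fixes f :: "'a \<Rightarrow> real"
  assumes "finite S" "a \<in> S"
  shows "(\<Sum>s\<in>S. (if s = a then 1 else 0) * f s) = f a"
proof -
  have "(\<Sum>s\<in>S. (if s = a then 1 else 0) * f s) = (\<Sum>s\<in>S. if s = a then f s else 0)"
    by (intro sum.cong) auto
  then show ?thesis using assms by simp
qed

lemma mat_rank_hankel_form_definite:
  assumes def: "\<And>q. q \<noteq> 0 \<Longrightarrow> degree q < r \<Longrightarrow> riesz g (q * q) \<noteq> 0"
  shows "mat_rank (hankel_form r g) = r"
proof -
  have "mat_rank (hankel_form r g) = card {..<r}"
  proof (rule mat_rank_eq_card[where b = "\<lambda>s i. g (i + s)"])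
    show "\<forall>s\<in>{..<r}. c s = 0" if "\<And>i. i < r \<Longrightarrow> (\<Sum>s<r. c s * g (i + s)) = 0" for c
      using hankel_columns_independent[OF def that] by simp
  next
    fix j assume "j < r"
    then show "\<exists>c. \<forall>i<r. hankel_form r g $$ (i, j) = (\<Sum>s<r. c s * g (i + s))"
      by (intro exI[of _ "\<lambda>s. if s = j then 1 else 0"]) (simp add: sum_unit_left)
  next
    fix s assume "s \<in> {..<r}"
    then show "\<exists>x. \<forall>i<r. g (i + s) = (\<Sum>j<r. x j * hankel_form r g $$ (i, j))"
      by (intro exI[of _ "\<lambda>j. if j = s then 1 else 0"]) (simp add: sum_unit_left)
  qed simp_all
  then show ?thesis by simp
qed

lemma monom_mult_eq_smult: "monom a s * P = Polynomial.smult a (P * monom (1::real) s)"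
proof -
  have "monom a s = Polynomial.smult a (monom 1 s)" by (simp add: smult_monom)
  then show ?thesis by (simp add: mult.commute)
qed

text \<open>Let \<open>p\<close> be a null vector of least degree r. Its multiples by powers of t
  stay null below the top degree, so the smaller matrix has rank r. The larger matrix would gain one
  rank unless t^(N-r) p is orthogonal to t^N as well; thus \<open>flat\<close> extends the
  orthogonality of \<open>p\<close> to all degrees that Gauss quadrature with r nodes requires. The
  hypothesis \<open>shift\<close> keeps 0 from being a node.\<close>

lemma flat_hankel_atoms:
  assumes psd: "\<And>f. degree f \<le> N \<Longrightarrow> riesz g (f * f) \<ge> 0"
    and flat: "mat_rank (hankel_form N g) = mat_rank (hankel_form (Suc N) g)"
    and shift: "mat_rank (hankel_form N (\<lambda>m. g (m + 2))) = mat_rank (hankel_form (Suc N) g)"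
  obtains S w where "finite S" "card S \<le> N" "0 \<notin> S" "\<And>s. s \<in> S \<Longrightarrow> w s > 0"
    "\<And>m. m \<le> 2 * N \<Longrightarrow> g m = (\<Sum>s\<in>S. w s * s ^ m)"
proof -
  define K where "K f \<longleftrightarrow> degree f \<le> N \<and> riesz g (f * f) = 0" for f
  have kernel: "riesz g (f * h) = 0" if "K f" "degree h \<le> N" for f h
    using riesz_kernel[OF psd] that by (auto simp: K_def)
  have "\<exists>p. p \<noteq> 0 \<and> K p"
  proof (rule ccontr)
    assume "\<not> ?thesis"
    then have "riesz g (q * q) \<noteq> 0" if "q \<noteq> 0" "degree q < Suc N" for q
      using that unfolding K_def less_Suc_eq_le by blast
    then have "mat_rank (hankel_form N g) = N" "mat_rank (hankel_form (Suc N) g) = Suc N"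
      using mat_rank_hankel_form_definite[of N g] mat_rank_hankel_form_definite[of "Suc N" g] by simp_all
    then show False using flat by simp
  qed
  then obtain p where p: "p \<noteq> 0" "K p"
    and least: "\<And>q. q \<noteq> 0 \<Longrightarrow> K q \<Longrightarrow> degree p \<le> degree q"
    using ex_has_least_nat[of "\<lambda>p. p \<noteq> 0 \<and> K p" _ degree] by blast
  define r where "r = degree p"
  have rN: "r \<le> N" using p by (simp add: K_def r_def)
  have pos: "riesz g (q * q) > 0" if "q \<noteq> 0" "degree q < r" for q
    using least[of q] that rN psd[of q] unfolding K_def r_def by fastforce
  \<comment> \<open>The square of t^(i+1) p equals t^i p times t^(i+2) p. The first factor is null
    by induction, and the second must have degree at most N; this is where the strict bound comes
    from.\<close>
  have mono_K: "K (p * monom 1 i)" if "i = 0 \<or> i + r < N" for i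
    using that
  proof (induction i)
    case 0
    then show ?case using p by simp
  next
    case (Suc i)
    have deg: "degree (p * monom 1 k) = r + k" for k
      using p(1) by (simp add: degree_mult_eq degree_monom_eq r_def)
    have "K (p * monom 1 i)" using Suc by auto
    then have "riesz g ((p * monom 1 i) * (p * monom 1 (Suc (Suc i)))) = 0"
      using Suc.prems deg by (intro kernel) auto
    moreover have "(p * monom 1 i) * (p * monom 1 (Suc (Suc i))) =
        (p * monom 1 (Suc i)) * (p * monom (1::real) (Suc i))"
    proof -
      have "(p * a) * (p * b) = p * p * (a * b)" for a b by (simp only: mult_ac)
      then show ?thesis by (simp add: mult_monom)
    qed
    ultimately show ?case using Suc.prems deg by (simp add: K_def)
  qed
  have mult_K: "riesz g (p * q * h) = 0" if "q = 0 \<or> degree q + r < N \<or> degree q = 0" "degree h \<le> N" for q h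
  proof (cases "q = 0")
    case False
    have "riesz g ((p * h) * q) = 0"
    proof (rule riesz_mult_eq_0)
      fix j assume "j \<le> degree q"
      then have "K (p * monom 1 j)" using that False by (intro mono_K) auto
      from kernel[OF this that(2)] show "riesz g ((p * h) * monom 1 j) = 0"
        by (simp add: mult.assoc mult.commute[of h])
    qed simp
    then show ?thesis by (simp add: mult.assoc mult.commute[of h])
  qed simp
  \<comment> \<open>Modulo the null multiples of \<open>p\<close>, each of the columns 0, ..., N - 1
    is a combination of the first r, even on all N + 1 rows.\<close>
  have reduce: "riesz g (monom 1 j * h) = riesz g ((monom 1 j mod p) * h)"
    if "j < N" "degree h \<le> N" for j h
  proof -
    have "monom 1 j * h = p * (monom 1 j div p) * h + (monom 1 j mod p) * h"
      by (metis distrib_right mult_div_mod_eq)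
    moreover have "monom 1 j div p = 0 \<or> degree (monom (1::real) j div p) + r < N"
    proof (rule disj_imp[THEN iffD2], rule impI)
      assume "monom 1 j div p \<noteq> 0"
      from degree_div_add_degree[OF p(1) this] show "degree (monom (1::real) j div p) + r < N"
        using that(1) by (simp add: degree_monom_eq r_def)
    qed
    then have "riesz g (p * (monom 1 j div p) * h) = 0" using that(2) by (intro mult_K) blast+
    ultimately show ?thesis by (simp add: riesz_add)
  qed
  have spanned: "\<exists>c. \<forall>i\<le>N. g (i + j) = (\<Sum>s<r. c s * g (i + s))" if j: "j < N" for j
  proof (intro exI allI impI)
    fix i assume i: "i \<le> N"
    let ?m = "monom 1 j mod p"
    have "g (i + j) = riesz g (monom 1 j * monom 1 i)" by (simp add: mult_monom riesz_monom add.commute)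
    also have "\<dots> = riesz g (?m * monom 1 i)" by (rule reduce[OF j order.trans[OF degree_monom_le i]])
    also have "?m = (\<Sum>s<r. monom (coeff ?m s) s)"
    proof (rule poly_eqI)
      fix k
      have "coeff ?m k = 0" if "\<not> k < r"
        using degree_mod_less'[OF p(1), of "monom 1 j"] that
        by (cases "?m = 0") (auto simp: r_def intro: coeff_eq_0)
      then show "coeff ?m k = coeff (\<Sum>s<r. monom (coeff ?m s) s) k"
        by (simp only: coeff_sum_monom) simp
    qed
    finally show "g (i + j) = (\<Sum>s<r. coeff ?m s * g (i + s))" by (simp only: riesz_sum_monom_mult)
  qed
  have indep: "\<forall>s\<in>{..<r}. c s = 0" if "\<And>i. i < N \<Longrightarrow> (\<Sum>s<r. c s * g (i + s)) = 0" for c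
    using hankel_columns_independent[of r g c] pos that rN by force
  have rank_N: "mat_rank (hankel_form N g) = r"
  proof -
    have "mat_rank (hankel_form N g) = card {..<r}"
    proof (rule mat_rank_eq_card[where b = "\<lambda>s i. g (i + s)"])
      fix j assume "j < N"
      from spanned[OF this] show "\<exists>c. \<forall>i<N. hankel_form N g $$ (i, j) = (\<Sum>s<r. c s * g (i + s))"
        using \<open>j < N\<close> by (elim ex_forward) simp
    next
      fix s assume "s \<in> {..<r}"
      then show "\<exists>x. \<forall>i<N. g (i + s) = (\<Sum>j<N. x j * hankel_form N g $$ (i, j))"
        using rN by (intro exI[of _ "\<lambda>j. if j = s then 1 else 0"]) (simp add: sum_unit_left)
    qed (simp, simp, rule indep)
    then show ?thesis by simp
  qed
  have top: "riesz g (p * monom 1 (N - r) * monom 1 N) = 0"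
  proof (cases "r = N")
    case True
    then show ?thesis using kernel[OF p(2), of "monom 1 N"] by (simp add: degree_monom_eq)
  next
    case False
    show ?thesis
    proof (rule ccontr)
      assume ne: "riesz g (p * monom 1 (N - r) * monom 1 N) \<noteq> 0"
      have low: "riesz g (p * monom 1 (N - r) * monom 1 i) = 0" if "i < N" for i
      proof -
        have "riesz g (p * monom 1 (N - r - 1) * monom 1 (Suc i)) = 0"
          using that False rN by (intro mult_K) (auto simp: degree_monom_eq)
        moreover have "monom 1 (N - r - 1) * monom 1 (Suc i) = monom (1::real) (N - r) * monom 1 i"
        proof -
          have "N - r - 1 + Suc i = N - r + i" using False rN by simp
          then show ?thesis by (simp only: mult_monom)
        qed
        ultimately show ?thesis by (simp only: mult.assoc)
      qed
      have "mat_rank (hankel_form (Suc N) g) = card (insert N {..<r})"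
      proof (rule mat_rank_eq_card[where b = "\<lambda>s i. g (i + s)"])
        fix c assume c: "\<And>i. i < Suc N \<Longrightarrow> (\<Sum>s\<in>insert N {..<r}. c s * g (i + s)) = 0"
        have Nr: "N \<notin> {..<r}" using rN by simp
        \<comment> \<open>The relation is paired with t^(N-r) p, which is orthogonal to every t^i
          with i < N but, by assumption, not to t^N. This isolates the coefficient of the last
          column.\<close>
        let ?f = "\<Sum>s\<in>insert N {..<r}. monom (c s) s"
        let ?P = "p * monom 1 (N - r)"
        have "riesz g (?f * ?P) = 0"
        proof (rule riesz_mult_eq_0[of N])
          show "degree ?P \<le> N" using p(1) rN by (simp add: degree_mult_eq degree_monom_eq r_def)
        qed (simp only: riesz_sum_monom_mult c less_Suc_eq_le)
        moreover have "riesz g (?f * ?P) = (\<Sum>s\<in>insert N {..<r}. c s * riesz g (?P * monom 1 s))"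
        proof -
          have "?f * ?P = (\<Sum>s\<in>insert N {..<r}. Polynomial.smult (c s) (?P * monom 1 s))"
            unfolding sum_distrib_right
            by (intro sum.cong refl monom_mult_eq_smult)
          then show ?thesis by (simp only: riesz_sum riesz_smult)
        qed
        ultimately have "c N * riesz g (?P * monom 1 N) = 0"
          using low rN Nr by simp
        then have cN: "c N = 0" using ne by simp
        then have "\<forall>s\<in>{..<r}. c s = 0"
          using c Nr by (intro indep) (metis (no_types, lifting) add_0 finite_lessThan less_SucI mult_zero_left sum.insert)
        then show "\<forall>s\<in>insert N {..<r}. c s = 0" using cN by simp
      next
        fix j assume j: "j < Suc N"
        show "\<exists>c. \<forall>i<Suc N. hankel_form (Suc N) g $$ (i, j) = (\<Sum>s\<in>insert N {..<r}. c s * g (i + s))"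
        proof (cases "j = N")
          case True
          then show ?thesis
            by (intro exI[of _ "\<lambda>s. if s = N then 1 else 0"]) (simp only: sum_unit_left finite_insert finite_lessThan insertI1, simp)
        next
          case False
          then obtain c where c: "\<forall>i\<le>N. g (i + j) = (\<Sum>s<r. c s * g (i + s))"
            using spanned j by (metis less_antisym)
          have "(\<Sum>s<r. c s * g (i + s)) = (\<Sum>s<r. (if s = N then 0 else c s) * g (i + s))" for i
            using rN by (intro sum.cong) auto
          then show ?thesis using c rN j
            by (intro exI[of _ "\<lambda>s. if s = N then 0 else c s"]) simp
        qed
      next
        fix s assume "s \<in> insert N {..<r}"
        then show "\<exists>x. \<forall>i<Suc N. g (i + s) = (\<Sum>j<Suc N. x j * hankel_form (Suc N) g $$ (i, j))"
          using rN by (intro exI[of _ "\<lambda>j. if j = s then 1 else 0"])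
            (auto simp: sum_unit_left simp del: sum.lessThan_Suc)
      qed auto
      then show False using rank_N flat rN by (simp add: False)
    qed
  qed
  have orth: "riesz g (p * h) = 0" if "degree h + r \<le> 2 * N" for h
  proof (rule riesz_mult_eq_0)
    fix j assume "j \<le> degree h"
    then have j: "j + r \<le> 2 * N" using that by simp
    show "riesz g (p * monom 1 j) = 0"
    proof (cases "j \<le> N")
      case True
      then show ?thesis by (intro kernel p) (simp add: degree_monom_eq)
    next
      case False
      show ?thesis
      proof (cases "j = N - r + N")
        case True
        then show ?thesis using top by (simp add: mult.assoc mult_monom)
      next
        case False
        \<comment> \<open>The power t^j is split so that t^(N-r-1) p is still a null vector and the
          other factor has degree at most N. The only exponent beyond this reach is j = 2N - r,
          which is the case settled by \<open>top\<close>.\<close>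
        define e where "e = j - (N - r - 1)"
        have e: "e \<le> N" "N - r - 1 + e = j" "r < N" using False \<open>\<not> j \<le> N\<close> j rN by (auto simp: e_def)
        have "riesz g (p * monom 1 (N - r - 1) * monom 1 e) = 0"
          using e by (intro mult_K) (auto simp: degree_monom_eq)
        then show ?thesis using e(2) by (simp add: mult.assoc mult_monom)
      qed
    qed
  qed simp
  obtain S w where S: "finite S" "card S = r" "\<And>s. s \<in> S \<Longrightarrow> w s > 0"
    and quad: "\<And>h. degree h \<le> 2 * N \<Longrightarrow> riesz g h = (\<Sum>s\<in>S. w s * poly h s)"
  proof (rule gauss_quadrature[OF p(1) r_def[symmetric], where M = "2 * N" and g = g])
    show "2 * r \<le> 2 * N + 2" using rN by simp
  qed (use pos orth in auto)
  have moments: "g m = (\<Sum>s\<in>S. w s * s ^ m)" if "m \<le> 2 * N" for m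
    using quad[of "monom 1 m"] that by (simp add: degree_monom_eq riesz_monom poly_monom)
  have "0 \<notin> S"
  proof
    assume 0: "0 \<in> S"
    \<comment> \<open>Shifting by two multiplies the weights by s^2 and so erases an atom at 0,
      which would lower the rank.\<close>
    have "mat_rank (hankel_form N (\<lambda>m. g (m + 2))) = card (S - {0})"
    proof (rule mat_rank_hankel_form_atoms[where w = "\<lambda>s. w s * s\<^sup>2"])
      show "card (S - {0}) \<le> N" using S rN by (metis card_Diff1_le le_trans)
      show "w s * s\<^sup>2 \<noteq> 0" if "s \<in> S - {0}" for s using S(3)[of s] that by simp
      fix m assume "m + 2 \<le> 2 * N"
      then have "g (m + 2) = (\<Sum>s\<in>S. w s * s ^ (m + 2))" by (rule moments)
      also have "\<dots> = (\<Sum>s\<in>S - {0}. w s * s ^ (m + 2))"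
        using S(1) by (intro sum.mono_neutral_right) auto
      finally show "g (m + 2) = (\<Sum>s\<in>S - {0}. w s * s\<^sup>2 * s ^ m)"
        by (simp add: power2_eq_square mult_ac)
    qed (use S in simp)
    then show False using shift flat rank_N S(1,2) 0 card_Diff1_less[OF S(1) 0] by simp
  qed
  then show thesis using that S moments rN by blast
qed

text \<open>The polynomial with root set \<open>S\<close> is monic, so its coefficients express
  column \<open>card S\<close> by the earlier ones. A relation at an earlier column i gives a monic
  polynomial of degree i whose square has value 0; as all weights are positive it vanishes on
  \<open>S\<close>, which is more roots than its degree allows.\<close>

lemma seq_rank_atoms:
  assumes len: "length \<gamma> = 2 * N + 1" and "finite S" "card S \<le> N" and w: "\<And>s. s \<in> S \<Longrightarrow> w s > 0"
    and \<gamma>: "\<And>m. m \<le> 2 * N \<Longrightarrow> \<gamma> ! m = (\<Sum>s\<in>S. w s * s ^ m)"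
  shows "seq_rank \<gamma> = card S"
proof -
  let ?A = "hankel \<gamma>"
  have A: "?A = hankel_form (Suc N) (\<lambda>m. \<gamma> ! m)" using len by (simp add: hankel_def)
  define p where "p = (\<Prod>s\<in>S. [:- s, 1:])"
  have p0: "p \<noteq> 0" unfolding p_def using assms(2) by simp
  have dp: "degree p = card S"
    unfolding p_def by (subst degree_prod_eq_sum_degree) auto
  have lead: "coeff p (card S) = 1"
    using lead_coeff_prod[of "\<lambda>s. [:- s, 1:]" S] dp by (simp add: p_def)
  have rel: "(\<Sum>j\<le>card S. coeff p j * \<gamma> ! (i + j)) = 0" if i: "i \<le> N" for i
  proof -
    have "(\<Sum>j\<le>card S. coeff p j * \<gamma> ! (i + j)) = riesz (\<lambda>m. \<gamma> ! m) (p * monom 1 i)"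
      by (simp add: riesz_mult_monom dp add.commute)
    also have "\<dots> = (\<Sum>s\<in>S. w s * poly (p * monom 1 i) s)"
    proof (rule riesz_atoms[OF \<gamma>])
      show "degree (p * monom 1 i) \<le> 2 * N"
        using p0 dp i assms(3) by (simp add: degree_mult_eq degree_monom_eq)
    qed
    also have "\<dots> = 0" using assms(2) by (intro sum.neutral) (auto simp: p_def poly_prod)
    finally show ?thesis .
  qed
  have col: "col ?A j \<in> carrier_vec (Suc N)" "i < Suc N \<Longrightarrow> j < Suc N \<Longrightarrow> col ?A j $ i = \<gamma> ! (i + j)" for i j
    unfolding A by (auto intro: carrier_vecI)
  have span_iff: "col ?A i \<in> vec_span (Suc N) {col ?A j | j. j < i} \<longleftrightarrow>
      (\<exists>c. \<forall>l<Suc N. \<gamma> ! (l + i) = (\<Sum>j<i. c j * \<gamma> ! (l + j)))" if "i \<le> N" for i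
  proof -
    have "{col ?A j | j. j < i} = col ?A ` {..<i}" by auto
    then show ?thesis
      using vec_span_image_iff[of "{..<i}" "col ?A" "Suc N" "col ?A i"] that col by simp
  qed
  have "\<not> invertible_mat ?A"
    unfolding A
  proof (rule not_invertible_matI)
    fix i assume "i < Suc N"
    then have "(\<Sum>j\<le>card S. coeff p j * \<gamma> ! (i + j)) = 0" by (intro rel) simp
    moreover have "(\<Sum>j<Suc N. \<gamma> ! (i + j) * coeff p j) = (\<Sum>j\<le>card S. coeff p j * \<gamma> ! (i + j))"
      using assms(3) dp by (intro sum.mono_neutral_cong_right) (auto simp: coeff_eq_0)
    ultimately show "(\<Sum>j<Suc N. \<gamma> ! (i + j) * coeff p j) = 0" by simp
  next
    show "card S < Suc N" using assms(3) by simp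
    show "coeff p (card S) \<noteq> 0" using lead by simp
  qed
  moreover have "(LEAST i. i \<le> N \<and> col ?A i \<in> vec_span (Suc N) {col ?A j | j. j < i}) = card S"
  proof (rule Least_equality)
    have "\<gamma> ! (l + card S) = (\<Sum>j<card S. - coeff p j * \<gamma> ! (l + j))" if "l < Suc N" for l
      using rel[of l] that lead
      by (simp add: sum_negf lessThan_Suc_atMost[symmetric] del: sum.lessThan_Suc) (simp add: lead)
    then show "card S \<le> N \<and> col ?A (card S) \<in> vec_span (Suc N) {col ?A j | j. j < card S}"
      using span_iff[OF assms(3)] assms(3) by (intro conjI) (auto intro!: exI[of _ "\<lambda>j. - coeff p j"])
  next
    fix i assume i: "i \<le> N \<and> col ?A i \<in> vec_span (Suc N) {col ?A j | j. j < i}"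
    then obtain c where c: "\<And>l. l < Suc N \<Longrightarrow> \<gamma> ! (l + i) = (\<Sum>j<i. c j * \<gamma> ! (l + j))"
      using span_iff by blast
    show "card S \<le> i"
    proof (rule ccontr)
      assume less: "\<not> card S \<le> i"
      define q where "q = monom 1 i - (\<Sum>j<i. monom (c j) j)"
      have q_coeff: "coeff q i = 1" by (simp add: q_def coeff_sum_monom)
      have dq: "degree q \<le> i"
        unfolding q_def by (intro degree_diff_le degree_sum_le) (auto intro: order.trans[OF degree_monom_le] simp: degree_monom_eq)
      have "riesz (\<lambda>m. \<gamma> ! m) (q * q) = 0"
      proof (rule riesz_mult_eq_0[OF _ dq])
        fix l assume "l \<le> i"
        then have l: "l < Suc N" using i by simp
        show "riesz (\<lambda>m. \<gamma> ! m) (q * monom 1 l) = 0"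
          unfolding q_def left_diff_distrib riesz_diff riesz_sum_monom_mult
          using c[OF l] by (simp add: mult_monom riesz_monom add.commute)
      qed
      moreover have "riesz (\<lambda>m. \<gamma> ! m) (q * q) = (\<Sum>s\<in>S. w s * poly (q * q) s)"
        using degree_mult_le[of q q] dq i by (intro riesz_atoms[OF \<gamma>]) auto
      ultimately have sum0: "(\<Sum>s\<in>S. w s * poly (q * q) s) = 0" by simp
      have nn: "w s * poly (q * q) s \<ge> 0" if "s \<in> S" for s using w[OF that] by simp
      have "\<forall>s\<in>S. w s * poly (q * q) s = 0"
        by (rule iffD1[OF sum_nonneg_eq_0_iff[OF assms(2) nn] sum0])
      then have sub: "S \<subseteq> {s. poly q s = 0}" using less_imp_neq[OF w] by auto
      have "q \<noteq> 0" using q_coeff by auto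
      then have "card S \<le> degree q"
        using card_poly_roots_bound[of q] card_mono[OF poly_roots_finite sub] by linarith
      then show False using dq less by simp
    qed
  qed
  ultimately show ?thesis using len by (simp add: seq_rank_def Let_def)
qed

section \<open>Completion of a definite Hankel form\<close>

lemma riesz_upd: "riesz (g(1 := x)) p = riesz (g(1 := 0)) p + x * coeff p 1"
proof -
  let ?N = "max 1 (degree p)"
  have "riesz (g(1 := x)) p = (\<Sum>i\<le>?N. coeff p i * (g(1 := 0)) i + (if i = 1 then x * coeff p 1 else 0))"
    unfolding riesz_altdef[of p ?N "g(1 := x)", OF max.cobounded2] by (intro sum.cong) auto
  also have "\<dots> = riesz (g(1 := 0)) p + x * coeff p 1"
    unfolding sum.distrib riesz_altdef[of p ?N "g(1 := 0)", OF max.cobounded2] by simp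
  finally show ?thesis .
qed

lemma riesz_upd_eq: "coeff p 1 = 0 \<Longrightarrow> riesz (g(1 := x)) p = riesz g p"
  by (rule riesz_cong) auto

text \<open>Only the value g 1 is free. The polynomials of degree at most n divisible by t^2 form a
  space on which, and against which, the form does not involve g 1. Splitting this space off
  orthogonally leaves a plane spanned by \<open>u\<close> and \<open>v\<close>, the residuals of 1
  and t, in which g 1 enters through the single inner product of \<open>u\<close> and
  \<open>v\<close>.\<close>

lemma definite_completion_atoms:
  assumes n: "n \<ge> 2"
    and P1: "\<And>f. f \<noteq> 0 \<Longrightarrow> degree f \<le> n \<Longrightarrow> coeff f 0 = 0 \<Longrightarrow> riesz g (f * f) > 0"
    and P2: "\<And>f. degree f \<le> n \<Longrightarrow> coeff f 1 = 0 \<Longrightarrow> riesz g (f * f) \<ge> 0"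
    and P3: "\<And>f. f \<noteq> 0 \<Longrightarrow> degree f < n \<Longrightarrow> coeff f 1 = 0 \<Longrightarrow> riesz g (f * f) > 0"
  obtains x S w where "finite S" "card S = n" "\<And>s. s \<in> S \<Longrightarrow> w s > 0"
    "\<And>h. degree h \<le> 2 * n \<Longrightarrow> riesz (g(1 := x)) h = (\<Sum>s\<in>S. w s * poly h s)"
proof -
  define V where "V f \<longleftrightarrow> degree f \<le> n \<and> coeff f 0 = 0 \<and> coeff f 1 = 0" for f :: "real poly"
  have perp: "riesz G (p * h) = 0"
    if orth: "\<And>j. 2 \<le> j \<Longrightarrow> j \<le> n \<Longrightarrow> riesz G (p * monom 1 j) = 0" and "V h" for G p h
  proof -
    have "coeff h j * riesz G (p * monom 1 j) = 0" if j: "j \<le> n" for j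
    proof (cases "j = 0 \<or> j = 1")
      case True
      then show ?thesis using \<open>V h\<close> by (auto simp: V_def)
    next
      case False
      then show ?thesis using orth[of j] j by simp
    qed
    then have "(\<Sum>j\<le>n. coeff h j * riesz G (p * monom 1 j)) = 0" by (intro sum.neutral) blast
    then show ?thesis using \<open>V h\<close> by (simp add: V_def riesz_mult_expand[of _ n])
  qed
  \<comment> \<open>The Gram matrix of t^2, ..., t^n has the entries g (i + j + 4). By
    \<open>P1\<close> its kernel is trivial, so every linear functional on the space is represented
    by an element of it.\<close>
  have solve: "\<exists>f. V f \<and> (\<forall>j\<in>{2..n}. riesz g (f * monom 1 j) = y j)" for y
  proof -
    let ?f = "\<lambda>x. \<Sum>j<n - 1. monom (x j) (j + 2)"
    have V: "V (?f x)" for x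
      unfolding V_def
    proof (intro conjI degree_sum_le)
      show "degree (monom (x j) (j + 2)) \<le> n" if "j \<in> {..<n - 1}" for j
        using that by (intro order.trans[OF degree_monom_le]) simp
    qed (simp_all add: coeff_sum)
    have val: "riesz g (?f x * monom 1 (i + 2)) = (\<Sum>j<n - 1. g (i + j + 4) * x j)" for x i
    proof -
      have "j + 2 + (i + 2) = i + j + 4" for j by simp
      then show ?thesis
        unfolding sum_distrib_right mult_monom riesz_sum riesz_monom
        by (simp only: mult_1_right mult_1_left mult.commute)
    qed
    have "\<exists>x. \<forall>i<n - 1. (\<Sum>j<n - 1. g (i + j + 4) * x j) = y (i + 2)"
    proof (rule solvable_of_trivial_kernel(1))
      fix x assume x: "\<And>i. i < n - 1 \<Longrightarrow> (\<Sum>j<n - 1. g (i + j + 4) * x j) = 0"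
      have "riesz g (?f x * ?f x) = 0"
      proof (rule perp[OF _ V])
        fix j assume "2 \<le> j" "j \<le> n"
        then have j: "j = (j - 2) + 2" "j - 2 < n - 1" by simp_all
        show "riesz g (?f x * monom 1 j) = 0"
          by (subst j(1)) (simp only: val x[OF j(2)])
      qed
      then have 0: "?f x = 0" using P1[of "?f x"] V[of x] by (auto simp: V_def)
      show "\<forall>j<n - 1. x j = 0"
      proof (intro allI impI)
        fix j assume "j < n - 1"
        then have "coeff (?f x) (j + 2) = x j" by (simp add: coeff_sum)
        then show "x j = 0" using 0 by simp
      qed
    qed
    then obtain x where x: "\<And>i. i < n - 1 \<Longrightarrow> (\<Sum>j<n - 1. g (i + j + 4) * x j) = y (i + 2)" by auto
    have "riesz g (?f x * monom 1 j) = y j" if "j \<in> {2..n}" for j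
    proof -
      have j: "j = (j - 2) + 2" "j - 2 < n - 1" using that by auto
      have "riesz g (?f x * monom 1 ((j - 2) + 2)) = y ((j - 2) + 2)" by (simp only: val x[OF j(2)])
      then show ?thesis using j(1) by simp
    qed
    then show ?thesis using V by blast
  qed
  \<comment> \<open>\<open>f\<close> is the orthogonal projection of 1 and the next polynomial
    \<open>h\<close> that of t; on t^j these two have the inner products g j and g (j + 1).\<close>
  obtain f where f: "V f" "\<And>j. j \<in> {2..n} \<Longrightarrow> riesz g (f * monom 1 j) = g j"
    using solve[of g] by blast
  obtain h where h: "V h" "\<And>j. j \<in> {2..n} \<Longrightarrow> riesz g (h * monom 1 j) = g (Suc j)"
    using solve[of "\<lambda>j. g (Suc j)"] by blast
  define u where "u = 1 - f"
  define v where "v = monom 1 1 - h"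
  have u: "degree u \<le> n" "coeff u 0 = 1" "coeff u 1 = 0"
    using f(1) by (auto simp: u_def V_def intro!: degree_diff_le)
  have v: "degree v \<le> n" "coeff v 0 = 0" "coeff v 1 = 1"
    using h(1) n by (auto simp: v_def V_def degree_monom_eq intro!: degree_diff_le)
  have u_perp_g: "riesz g (u * monom 1 j) = 0" if "2 \<le> j" "j \<le> n" for j
    using f(2)[of j] that by (simp add: u_def left_diff_distrib riesz_diff riesz_monom)
  have v_perp_g: "riesz g (v * monom 1 j) = 0" if "2 \<le> j" "j \<le> n" for j
    using h(2)[of j] that by (simp add: v_def left_diff_distrib riesz_diff riesz_monom mult_monom)
  have coeff_shift: "coeff (p * monom 1 j) i = (if i < j then 0 else coeff p (i - j))" for p :: "real poly" and i j
    using coeff_monom_mult[of 1 j p i] by (simp add: mult.commute)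
  have u_perp: "riesz (g(1 := x)) (u * monom 1 j) = 0" if "2 \<le> j" "j \<le> n" for x j
    using u_perp_g[OF that] that by (subst riesz_upd_eq) (simp_all add: coeff_shift)
  have v_perp: "riesz (g(1 := x)) (v * monom 1 j) = 0" if "2 \<le> j" "j \<le> n" for x j
    using v_perp_g[OF that] that by (subst riesz_upd_eq) (simp_all add: coeff_shift)
  define a where "a = riesz g u"
  define b where "b = riesz g (v * monom 1 1)"
  have coeff_1_mult: "coeff (p * q) 1 = coeff p 0 * coeff q 1 + coeff p 1 * coeff q 0" for p q :: "real poly"
    by (simp add: coeff_mult atMost_Suc)
  have uu: "riesz g (u * u) = a"
  proof -
    have "u * u = u - u * f" by (simp add: u_def algebra_simps)
    then show ?thesis using perp[of g u f] u_perp_g f(1) by (simp add: riesz_diff a_def)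
  qed
  have vv: "riesz g (v * v) = b"
  proof -
    have "v * v = v * monom 1 1 - v * h" by (simp add: v_def algebra_simps)
    then show ?thesis using perp[of g v h] v_perp_g h(1) by (simp add: riesz_diff b_def)
  qed
  have uv: "riesz (g(1 := x)) (u * v) = riesz (g(1 := x)) (u * monom 1 1)" for x
  proof -
    have "u * v = u * monom 1 1 - u * h" by (simp add: v_def algebra_simps)
    then show ?thesis using perp[of "g(1 := x)" u h] u_perp h(1) by (simp add: riesz_diff)
  qed
  have uv': "riesz (g(1 := x)) (u * v) = riesz (g(1 := x)) v" for x
  proof -
    have "u * v = v - v * f" by (simp add: u_def algebra_simps)
    then show ?thesis using perp[of "g(1 := x)" v f] v_perp f(1) by (simp add: riesz_diff)
  qed
  have a: "a \<ge> 0" using P2[of u] u uu by simp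
  have "v \<noteq> 0" using v(3) by auto
  then have b: "b > 0" using P1[of v] v vv by simp
  txt \<open>With \<open>g 1\<close> chosen so that \<open>u\<close> and \<open>v\<close> have inner product \<open>\<delta>\<close>, their Gram matrix is singular, with
    kernel \<open>b u - \<delta> v\<close>, exactly for \<open>\<delta>\<^sup>2 = a b\<close>. If this had degree below \<open>n\<close> for both signs, then
    either \<open>a = 0\<close>, against the definiteness below degree \<open>n\<close>, or a
    combination \<open>z\<close> of \<open>u\<close> and \<open>v\<close> of degree at most \<open>n - 2\<close> would make \<open>t z\<close> a null vector.\<close>
  have "\<exists>\<delta>. \<delta>\<^sup>2 = a * b \<and> b * coeff u n - \<delta> * coeff v n \<noteq> 0"
  proof (rule ccontr)
    assume "\<not> ?thesis"
    then have none: "b * coeff u n - \<delta> * coeff v n = 0" if "\<delta>\<^sup>2 = a * b" for \<delta> using that by blast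
    define s where "s = sqrt (a * b)"
    have s2: "s\<^sup>2 = a * b" using a b by (simp add: s_def)
    have "b * coeff u n = 0" "s * coeff v n = 0" using none[of s] none[of "- s"] s2 by simp_all
    then have cu: "coeff u n = 0" using b by simp
    have less: "degree p < n" if "degree p \<le> n" "coeff p n = 0" for p :: "real poly"
      using that n by (metis coeff_0 degree_0 leading_coeff_0_iff le_neq_implies_less less_le_trans pos2)
    have "u \<noteq> 0" using u(2) by auto
    then have "a > 0" using P3[of u] less[OF u(1) cu] u(3) uu by simp
    then have "s > 0" using b by (simp add: s_def)
    then have cv: "coeff v n = 0" using \<open>s * coeff v n = 0\<close> by simp
    obtain \<alpha> \<beta> where \<alpha>\<beta>: "\<alpha> * coeff u (n - 1) + \<beta> * coeff v (n - 1) = 0" "\<alpha> \<noteq> 0 \<or> \<beta> \<noteq> 0"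
    proof (cases "coeff u (n - 1) = 0")
      case True
      then show ?thesis using that[of 1 0] by simp
    next
      case False
      then show ?thesis using that[of "coeff v (n - 1)" "- coeff u (n - 1)"] by simp
    qed
    define z where "z = Polynomial.smult \<alpha> u + Polynomial.smult \<beta> v"
    have z01: "coeff z 0 = \<alpha>" "coeff z 1 = \<beta>" using u v by (simp_all add: z_def)
    have z0: "z \<noteq> 0" using \<alpha>\<beta>(2) z01 by auto
    have dz: "degree z \<le> n - 2"
    proof (rule degree_le, intro allI impI)
      fix i assume "n - 2 < i"
      then consider "i = n - 1" | "i = n" | "i > n" using n by linarith
      then show "coeff z i = 0"
        using \<alpha>\<beta>(1) cu cv u(1) v(1) by cases (simp_all add: z_def coeff_eq_0)
    qed
    have deg_shift: "degree (z * monom 1 j) = degree z + j" for j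
      using z0 by (simp add: degree_mult_eq degree_monom_eq)
    have "riesz g (z * (z * monom 1 2)) = 0"
    proof (rule perp)
      show "riesz g (z * monom 1 j) = 0" if "2 \<le> j" "j \<le> n" for j
        using u_perp_g[OF that] v_perp_g[OF that]
        by (simp add: z_def distrib_right riesz_add riesz_smult)
      show "V (z * monom 1 2)" using deg_shift[of 2] dz n by (simp add: V_def coeff_shift)
    qed
    moreover have "(z * monom 1 1) * (z * monom 1 1) = z * (z * monom (1::real) 2)"
    proof -
      have "(z * c) * (z * c) = z * (z * (c * c))" for c by (simp only: mult_ac)
      then show ?thesis by (simp add: mult_monom numeral_2_eq_2)
    qed
    moreover have "riesz g ((z * monom 1 1) * (z * monom 1 1)) > 0"
    proof (rule P1)
      show "z * monom 1 1 \<noteq> 0" using z0 by simp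
      show "degree (z * monom 1 1) \<le> n" using deg_shift[of 1] dz n by simp
      show "coeff (z * monom 1 1) 0 = 0" by (simp add: coeff_shift)
    qed
    ultimately show False by (metis less_irrefl)
  qed
  then obtain \<delta> where \<delta>: "\<delta>\<^sup>2 = a * b" "b * coeff u n - \<delta> * coeff v n \<noteq> 0" by blast
  \<comment> \<open>The product t u has linear coefficient \<open>coeff u 0 = 1\<close>, so the
    inner product of \<open>u\<close> and \<open>v\<close> grows with slope 1 in the missing moment
    and can be given the value \<delta>.\<close>
  define x where "x = \<delta> - riesz (g(1 := 0)) (u * monom 1 1)"
  define G where "G = g(1 := x)"
  have G_uv: "riesz G (u * v) = \<delta>"
    unfolding G_def uv riesz_upd[of g x] by (simp add: x_def coeff_shift u(2))
  have G_u1: "riesz G (u * monom 1 1) = \<delta>" using G_uv uv[of x] by (simp add: G_def)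
  have G_v: "riesz G v = \<delta>" using G_uv uv'[of x] by (simp add: G_def)
  have G_u: "riesz G u = a" unfolding G_def a_def using u(3) by (rule riesz_upd_eq)
  have G_v1: "riesz G (v * monom 1 1) = b"
    unfolding G_def b_def by (rule riesz_upd_eq) (simp add: coeff_shift v(2))
  have G_uu: "riesz G (u * u) = a"
    unfolding G_def uu[symmetric] by (rule riesz_upd_eq) (simp add: coeff_1_mult[unfolded One_nat_def] u[unfolded One_nat_def])
  have G_vv: "riesz G (v * v) = b"
    unfolding G_def vv[symmetric] by (rule riesz_upd_eq) (simp add: coeff_1_mult[unfolded One_nat_def] v[unfolded One_nat_def])
  define p where "p = Polynomial.smult b u - Polynomial.smult \<delta> v"
  have pn: "coeff p n \<noteq> 0" using \<delta>(2) by (simp add: p_def)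
  have "degree p \<le> n" unfolding p_def using u(1) v(1) by (intro degree_diff_le order.trans[OF degree_smult_le])
  then have dp: "degree p = n" using le_degree[OF pn] by simp
  have p0: "p \<noteq> 0" using pn by auto
  have p_perp: "riesz G (p * monom 1 j) = 0" if "j \<le> n" for j
  proof -
    have eq: "riesz G (p * monom 1 j) = b * riesz G (u * monom 1 j) - \<delta> * riesz G (v * monom 1 j)"
      by (simp add: p_def left_diff_distrib riesz_diff riesz_smult)
    consider "j = 0" | "j = 1" | "2 \<le> j" by linarith
    then show ?thesis
    proof cases
      case 1
      then show ?thesis using eq G_u G_v \<delta>(1) by (simp add: power2_eq_square mult.commute)
    next
      case 2
      then show ?thesis using eq G_u1 G_v1 by simp
    next
      case 3
      then show ?thesis using eq u_perp v_perp that by (simp add: G_def)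
    qed
  qed
  have pos: "riesz G (q * q) > 0" if q: "q \<noteq> 0" "degree q < n" for q
  proof -
    \<comment> \<open>The constant and linear coefficients of \<open>q\<close> determine its
      component \<open>z\<close> in the plane of \<open>u\<close> and \<open>v\<close>; the rest
      \<open>y\<close> is divisible by t^2 and orthogonal to it.\<close>
    define \<alpha> \<beta> where "\<alpha> = coeff q 0" and "\<beta> = coeff q 1"
    define z where "z = Polynomial.smult \<alpha> u + Polynomial.smult \<beta> v"
    define y where "y = q - z"
    have "degree z \<le> n" unfolding z_def
      using u(1) v(1) by (intro degree_add_le order.trans[OF degree_smult_le])
    then have Vy: "V y" unfolding V_def y_def
      using q(2) u v by (auto intro!: degree_diff_le simp: z_def \<alpha>_def \<beta>_def)
    have "riesz G (z * y) = 0"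
    proof (rule perp[OF _ Vy])
      show "riesz G (z * monom 1 j) = 0" if "2 \<le> j" "j \<le> n" for j
        using u_perp[OF that] v_perp[OF that]
        by (simp add: z_def distrib_right riesz_add riesz_smult G_def)
    qed
    moreover have "q * q = z * z + (z * y + z * y) + y * y" by (simp add: y_def algebra_simps)
    ultimately have qq: "riesz G (q * q) = riesz G (z * z) + riesz G (y * y)"
      by (simp only: riesz_add add_0_left add_0_right)
    have yy: "y \<noteq> 0 \<Longrightarrow> riesz G (y * y) > 0"
      using P1[of y] Vy unfolding G_def
      by (subst riesz_upd_eq) (auto simp: V_def coeff_1_mult[unfolded One_nat_def])
    have "z * z = Polynomial.smult (\<alpha> * \<alpha>) (u * u) + (Polynomial.smult (\<alpha> * \<beta>) (u * v) + Polynomial.smult (\<alpha> * \<beta>) (u * v))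
        + Polynomial.smult (\<beta> * \<beta>) (v * v)"
      by (simp add: z_def distrib_left distrib_right smult_add_right mult.commute)
    then have "riesz G (z * z) = \<alpha> * \<alpha> * a + 2 * (\<alpha> * \<beta> * \<delta>) + \<beta> * \<beta> * b"
      by (simp only: riesz_add riesz_smult G_uu G_uv G_vv)
    then have "b * riesz G (z * z) = \<alpha> * \<alpha> * (a * b) + 2 * (\<alpha> * \<beta> * \<delta>) * b + \<beta> * \<beta> * b * b"
      by (simp add: algebra_simps)
    also have "\<dots> = (\<alpha> * \<delta> + \<beta> * b)\<^sup>2"
      unfolding \<delta>(1)[symmetric] by (simp add: power2_eq_square algebra_simps)
    finally have zz: "b * riesz G (z * z) = (\<alpha> * \<delta> + \<beta> * b)\<^sup>2" .
    show ?thesis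
    proof (cases "y = 0")
      case False
      have "riesz G (z * z) \<ge> 0" using zz b by (metis zero_le_mult_iff zero_le_power2 not_less)
      then show ?thesis using yy[OF False] qq by simp
    next
      case True
      then have qz: "q = z" by (simp add: y_def)
      \<comment> \<open>If this vanished, b q would equal \<alpha> p. As \<open>p\<close> has degree
        n and \<open>q\<close> a smaller one, both would be zero.\<close>
      have "\<alpha> * \<delta> + \<beta> * b \<noteq> 0"
      proof
        assume eq: "\<alpha> * \<delta> + \<beta> * b = 0"
        have "b * coeff q n = \<alpha> * (b * coeff u n) + (\<beta> * b) * coeff v n"
          by (simp add: qz z_def algebra_simps)
        also have "\<beta> * b = - (\<alpha> * \<delta>)" using eq by linarith
        finally have "\<alpha> * (b * coeff u n - \<delta> * coeff v n) = 0"
          using coeff_eq_0[OF q(2)] by (auto simp: algebra_simps)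
        then have "\<alpha> = 0" using \<delta>(2) by simp
        moreover then have "\<beta> = 0" using eq b by simp
        ultimately show False using q(1) qz by (simp add: z_def)
      qed
      then have "b * riesz G (z * z) > 0" using zz by simp
      then show ?thesis using qz b by (simp add: zero_less_mult_iff)
    qed
  qed
  have orth: "riesz G (p * h) = 0" if "degree h + n \<le> 2 * n" for h
    by (rule riesz_mult_eq_0[OF p_perp]) (use that in simp_all)
  have "2 * n \<le> 2 * n + 2" by simp
  from gauss_quadrature[OF p0 dp pos orth this]
  obtain S w where "finite S" "card S = n" "\<And>s. s \<in> S \<Longrightarrow> w s > 0"
    "\<And>h. degree h \<le> 2 * n \<Longrightarrow> riesz G h = (\<Sum>s\<in>S. w s * poly h s)" by metis
  then show thesis using that[of S w x] unfolding G_def by blast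
qed

section \<open>The univariate sequence of the cusp\<close>

text \<open>The moment of t^m is read off the monomial x^i y^j with 2i + 3j = m and i at most 2, the
  normal form modulo y^2 = x^3. For m = 1 there is no such monomial: truncated subtraction gives the
  default value \<open>\<beta> 2 0\<close>, which carries no information about the moment of
  t.\<close>

definition cusp_seq :: "(nat \<Rightarrow> nat \<Rightarrow> real) \<Rightarrow> nat \<Rightarrow> real" where
  "cusp_seq \<beta> m =
     (if m mod 3 = 0 then \<beta> 0 (m div 3)
      else if m mod 3 = 2 then \<beta> 1 (m div 3)
      else \<beta> 2 (m div 3 - 1))"

lemma cusp_seq_simps:
  "cusp_seq \<beta> (3 * j) = \<beta> 0 j"
  "cusp_seq \<beta> (3 * j + 2) = \<beta> 1 j"
  "cusp_seq \<beta> (3 * j + 4) = \<beta> 2 j"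
proof -
  have "(3 * j + 2) mod 3 = 2" "(3 * j + 2) div 3 = j" "(3 * j + 4) mod 3 = 1" "(3 * j + 4) div 3 = j + 1"
    by presburger+
  then show "cusp_seq \<beta> (3 * j) = \<beta> 0 j" "cusp_seq \<beta> (3 * j + 2) = \<beta> 1 j"
    "cusp_seq \<beta> (3 * j + 4) = \<beta> 2 j"
    by (simp_all only: cusp_seq_def) simp_all
qed

text \<open>Replacing x^3 by y^2 keeps 2i + 3j, lowers i + j, and ends at the normal form with i at
  most 2.\<close>

lemma cusp_seq_eq:
  assumes rel: "\<And>i j. i + j + 3 \<le> 2 * k \<Longrightarrow> \<beta> (i + 3) j = \<beta> i (j + 2)"
    and "i + j \<le> 2 * k"
  shows "\<beta> i j = cusp_seq \<beta> (2 * i + 3 * j)"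
  using assms(2)
proof (induction i arbitrary: j rule: less_induct)
  case (less i)
  consider "i = 0" | "i = 1" | "i = 2" | "i \<ge> 3" by linarith
  then show ?case
  proof cases
    case 4
    define l where "l = i - 3"
    with 4 have l: "i = l + 3" by simp
    have "\<beta> i j = \<beta> l (j + 2)" using rel[of l j] less.prems l by simp
    also have "\<dots> = cusp_seq \<beta> (2 * l + 3 * (j + 2))" using less.prems l by (intro less.IH) auto
    also have "2 * l + 3 * (j + 2) = 2 * i + 3 * j" using l by simp
    finally show ?thesis .
  qed (use cusp_seq_simps[of \<beta> j] in \<open>simp_all add: add.commute\<close>)
qed

text \<open>A block lists x y^i, y^(i+1), x^2 y^i, that is, the consecutive powers t^(3i+2),
  t^(3i+3), t^(3i+4). Concatenated blocks thus form an interval of exponents.\<close>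

lemma concat_blocks:
  assumes "a \<le> b"
  shows "concat (map (block \<beta>) [a..<b]) = map (cusp_seq \<beta>) [3 * a + 2..<3 * b + 2]"
  using assms
proof (induction b rule: dec_induct)
  case (step b)
  have "block \<beta> b = map (cusp_seq \<beta>) [3 * b + 2, 3 * (b + 1), 3 * b + 4]"
    by (simp only: block_def list.map cusp_seq_simps)
  moreover have "[3 * a + 2..<3 * Suc b + 2] = [3 * a + 2..<3 * b + 2] @ [3 * b + 2, 3 * (b + 1), 3 * b + 4]"
  proof -
    have "3 * Suc b + 2 = Suc (Suc (Suc (3 * b + 2)))" by simp
    then show ?thesis using step.hyps by (simp only: upt_Suc) simp
  qed
  ultimately show ?case using step by simp
qed simp

lemma upt_two: "a \<le> b \<Longrightarrow> [a..<b + 2] = [a..<b] @ [b, b + 1]"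
  by (simp add: numeral_2_eq_2)

context
  fixes k :: nat and \<beta> :: "nat \<Rightarrow> nat \<Rightarrow> real"
  assumes k: "k \<ge> 1"
begin

lemma beta_hat_eq: "beta_hat \<beta> k = map (cusp_seq \<beta>) [2..<6 * k - 1]"
proof -
  have "3 * (2 * k - 1) + 2 = 6 * k - 1" "3 * 0 + 2 = (2::nat)" using k by simp_all
  then show ?thesis using concat_blocks[of 0 "2 * k - 1" \<beta>] by (simp only: beta_hat_def le0)
qed

lemma beta_bar_eq: "beta_bar \<beta> k = map (cusp_seq \<beta>) [4..<6 * k - 1]"
proof -
  have "3 * (2 * k - 1) + 2 = 6 * k - 1" "3 * 1 + 2 = (5::nat)" "1 \<le> 2 * k - 1" using k by simp_all
  then have "concat (map (block \<beta>) [1..<2 * k - 1]) = map (cusp_seq \<beta>) [5..<6 * k - 1]"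
    using concat_blocks[of 1 "2 * k - 1" \<beta>] by (simp only:)
  moreover have "cusp_seq \<beta> 4 = \<beta> 2 0" using cusp_seq_simps(3)[of \<beta> 0] by simp
  moreover
  have "[4..<6 * k - 1] = 4 # [5..<6 * k - 1]" using k by (subst upt_conv_Cons) auto
  ultimately show ?thesis by (simp only: beta_bar_def list.map)
qed

lemma last_two_entries: "[\<beta> 1 (2 * k - 1), \<beta> 0 (2 * k)] = map (cusp_seq \<beta>) [6 * k - 1, 6 * k - 1 + 1]"
proof -
  have "6 * k - 1 = 3 * (2 * k - 1) + 2" "6 * k - 1 + 1 = 3 * (2 * k)" using k by simp_all
  then show ?thesis by (simp only: list.map cusp_seq_simps)
qed

lemma beta_tilde_eq: "beta_tilde \<beta> k = map (cusp_seq \<beta>) [2..<6 * k + 1]"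
  and beta_breve_eq: "beta_breve \<beta> k = map (cusp_seq \<beta>) [4..<6 * k + 1]"
proof -
  have "6 * k + 1 = 6 * k - 1 + 2" using k by simp
  moreover have "[2..<6 * k - 1 + 2] = [2..<6 * k - 1] @ [6 * k - 1, 6 * k - 1 + 1]"
    "[4..<6 * k - 1 + 2] = [4..<6 * k - 1] @ [6 * k - 1, 6 * k - 1 + 1]"
    using k by (intro upt_two; simp)+
  ultimately show "beta_tilde \<beta> k = map (cusp_seq \<beta>) [2..<6 * k + 1]"
    "beta_breve \<beta> k = map (cusp_seq \<beta>) [4..<6 * k + 1]"
    by (simp_all only: beta_tilde_def beta_breve_def beta_hat_eq beta_bar_eq last_two_entries map_append)
qed

lemma v_row_eq: "v_row \<beta> k = map (cusp_seq \<beta>) [2..<3 * k]"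
proof -
  have "3 * k = Suc (3 * (k - 1) + 2)" using k by simp
  then have "[2..<3 * k] = [2..<3 * (k - 1) + 2] @ [3 * (k - 1) + 2]" by (simp only: upt_Suc) simp
  moreover have "3 * 0 + 2 = (2::nat)" by simp
  ultimately show ?thesis using concat_blocks[of 0 "k - 1" \<beta>]
    by (simp only: v_row_def le0 map_append list.map cusp_seq_simps)
qed

lemma hankel_map_upt:
  assumes "b + 1 = a + 2 * N" "N > 0"
  shows "hankel (map g [a..<b]) = hankel_form N (\<lambda>i. g (i + a))"
proof -
  have len: "length (map g [a..<b]) div 2 + 1 = N" using assms by simp
  have "map g [a..<b] ! (i + j) = g (i + j + a)" if "i < N" "j < N" for i j
    using that assms by (subst nth_map) (simp_all add: add.commute del: upt_Suc)
  then show ?thesis unfolding hankel_def len by (intro eq_matI) (simp_all del: upt_Suc)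
qed

text \<open>A shift by 2 d makes t^d the first basis element: the four matrices are the Gram
  matrices of t, ..., t^(3k-1); of t, ..., t^(3k); of t^2, ..., t^(3k-1); and of t^2, ...,
  t^(3k).\<close>

lemma hankel_hat: "hankel (beta_hat \<beta> k) = hankel_form (3 * k - 1) (\<lambda>i. cusp_seq \<beta> (i + 2))"
  and hankel_tilde: "hankel (beta_tilde \<beta> k) = hankel_form (3 * k) (\<lambda>i. cusp_seq \<beta> (i + 2))"
  and hankel_bar: "hankel (beta_bar \<beta> k) = hankel_form (3 * k - 2) (\<lambda>i. cusp_seq \<beta> (i + 4))"
  and hankel_breve: "hankel (beta_breve \<beta> k) = hankel_form (3 * k - 1) (\<lambda>i. cusp_seq \<beta> (i + 4))"
  unfolding beta_hat_eq beta_tilde_eq beta_bar_eq beta_breve_eq using k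
  by (intro hankel_map_upt; simp)+

lemma A_tilde_eq:
  "A_tilde \<beta> k = Matrix.mat (3 * k - 1) (3 * k - 1)
     (\<lambda>(i, j). cusp_seq \<beta> ((if i = 0 then 0 else i + 1) + (if j = 0 then 0 else j + 1)))" (is "_ = ?B")
proof (rule eq_matI)
  have len: "dim_vec (vec_of_list (v_row \<beta> k)) = 3 * k - 2" by (simp add: v_row_eq)
  show "dim_row (A_tilde \<beta> k) = dim_row ?B"
    "dim_col (A_tilde \<beta> k) = dim_col ?B"
    using k by (simp_all add: A_tilde_def Let_def hankel_bar)
  fix i j assume "i < dim_row ?B"
    "j < dim_col ?B"
  then have ij: "i < 3 * k - 1" "j < 3 * k - 1" by simp_all
  have v: "vec_of_list (v_row \<beta> k) $ l = cusp_seq \<beta> (l + 2)" if "l < 3 * k - 2" for l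
    using that by (simp add: vec_of_list_index v_row_eq add.commute)
  have c0: "cusp_seq \<beta> 0 = \<beta> 0 0" by (simp add: cusp_seq_def)
  have dims: "1 + (3 * k - 2) = 3 * k - 1" using k by simp
  show "A_tilde \<beta> k $$ (i, j) = ?B $$ (i, j)"
    using ij len dims k
    by (cases i; cases j) (simp_all add: A_tilde_def Let_def hankel_bar v c0 mat_of_row_def add.commute add.left_commute numeral_eq_Suc)
qed

end

text \<open>The matrix is the Gram matrix of the monomials t^(e i). The exponents may repeat, as
  they do in a moment matrix, where x^3 and y^2 both become t^6.\<close>

lemma quadratic_form_eq_riesz:
  assumes "x \<in> carrier_vec N"
  shows "scalar_prod x (Matrix.mat N N (\<lambda>(i, j). g (e i + e j)) *\<^sub>v x) =
    riesz g ((\<Sum>i<N. monom (x $ i) (e i)) * (\<Sum>i<N. monom (x $ i) (e i)))"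
proof -
  have "scalar_prod x (Matrix.mat N N (\<lambda>(i, j). g (e i + e j)) *\<^sub>v x) =
      (\<Sum>i<N. x $ i * (\<Sum>j<N. g (e i + e j) * x $ j))"
    using assms by (simp add: scalar_prod_def atLeast0LessThan)
  also have "\<dots> = (\<Sum>i<N. \<Sum>j<N. x $ i * x $ j * g (e i + e j))"
    by (simp add: sum_distrib_left mult_ac)
  also have "\<dots> = riesz g (\<Sum>i<N. \<Sum>j<N. monom (x $ i) (e i) * monom (x $ j) (e j))"
    by (simp add: riesz_sum mult_monom riesz_monom)
  finally show ?thesis by (simp add: sum_product)
qed

lemma symmetric_moment_form:
  "transpose_mat (Matrix.mat N N (\<lambda>(i, j). g (e i + e j :: nat))) = Matrix.mat N N (\<lambda>(i, j). g (e i + e j))"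
  by (intro eq_matI) (simp_all add: add.commute)

lemma pos_semidef_iff_riesz:
  "pos_semidef (Matrix.mat N N (\<lambda>(i, j). g (e i + e j))) \<longleftrightarrow>
    (\<forall>x. riesz g ((\<Sum>i<N. monom (x i) (e i)) * (\<Sum>i<N. monom (x i) (e i))) \<ge> 0)"
proof -
  have "(\<forall>v\<in>carrier_vec N. riesz g ((\<Sum>i<N. monom (v $ i) (e i)) * (\<Sum>i<N. monom (v $ i) (e i))) \<ge> 0) \<longleftrightarrow>
    (\<forall>x. riesz g ((\<Sum>i<N. monom (x i) (e i)) * (\<Sum>i<N. monom (x i) (e i))) \<ge> 0)" (is "?l \<longleftrightarrow> ?r")
  proof
    assume ?l
    show ?r
    proof
      fix x
      from \<open>?l\<close>[rule_format, of "Matrix.vec N x"]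
      show "riesz g ((\<Sum>i<N. monom (x i) (e i)) * (\<Sum>i<N. monom (x i) (e i))) \<ge> 0" by simp
    qed
  qed blast
  then show ?thesis
    unfolding pos_semidef_def using symmetric_moment_form[of N g e]
    by (simp add: quadratic_form_eq_riesz)
qed

lemma pos_def_iff_riesz:
  "pos_def (Matrix.mat N N (\<lambda>(i, j). g (e i + e j))) \<longleftrightarrow>
    (\<forall>x. (\<exists>i<N. x i \<noteq> 0) \<longrightarrow> riesz g ((\<Sum>i<N. monom (x i) (e i)) * (\<Sum>i<N. monom (x i) (e i))) > 0)"
proof -
  have "(\<forall>v\<in>carrier_vec N. v \<noteq> 0\<^sub>v N \<longrightarrow> riesz g ((\<Sum>i<N. monom (v $ i) (e i)) * (\<Sum>i<N. monom (v $ i) (e i))) > 0) \<longleftrightarrow>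
    (\<forall>x. (\<exists>i<N. x i \<noteq> 0) \<longrightarrow> riesz g ((\<Sum>i<N. monom (x i) (e i)) * (\<Sum>i<N. monom (x i) (e i))) > 0)" (is "?l \<longleftrightarrow> ?r")
  proof
    assume ?l
    show ?r
    proof (intro allI impI)
      fix x assume "\<exists>i<N. x i \<noteq> (0::real)"
      then have "Matrix.vec N x \<noteq> 0\<^sub>v N" by (metis index_vec index_zero_vec(1))
      with \<open>?l\<close>[rule_format, of "Matrix.vec N x"]
      show "riesz g ((\<Sum>i<N. monom (x i) (e i)) * (\<Sum>i<N. monom (x i) (e i))) > 0" by simp
    qed
  next
    assume ?r
    show ?l
    proof (intro ballI impI)
      fix v :: "real Matrix.vec" assume v: "v \<in> carrier_vec N" "v \<noteq> 0\<^sub>v N"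
      then have "\<exists>i<N. v $ i \<noteq> 0" by auto
      then show "riesz g ((\<Sum>i<N. monom (v $ i) (e i)) * (\<Sum>i<N. monom (v $ i) (e i))) > 0"
        using \<open>?r\<close> by simp
    qed
  qed
  then show ?thesis
    unfolding pos_def_def using symmetric_moment_form[of N g e]
    by (simp add: quadratic_form_eq_riesz)
qed

section \<open>Forms on polynomials and the moment matrix\<close>

lemma poly_eq_sum_monom_image:
  fixes e :: "nat \<Rightarrow> nat"
  assumes "\<And>m. coeff f m \<noteq> 0 \<Longrightarrow> m \<in> e ` {..<N}"
  obtains x where "f = (\<Sum>i<N. monom (x i) (e i))"
proof -
  obtain I where I: "I \<subseteq> {..<N}" "inj_on e I" "e ` {..<N} = e ` I"
    by (meson subset_image_inj subset_refl)
  have fin: "finite I" by (rule finite_subset[OF I(1)]) simp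
  define x where "x i = (if i \<in> I then coeff f (e i) else 0)" for i
  have "coeff f m = coeff (\<Sum>i<N. monom (x i) (e i)) m" for m
  proof -
    have "coeff (\<Sum>i<N. monom (x i) (e i)) m = (\<Sum>i<N. if e i = m then x i else 0)"
      by (simp add: coeff_sum)
    also have "\<dots> = (\<Sum>i\<in>I. if e i = m then coeff f (e i) else 0)"
      using I(1) by (intro sum.mono_neutral_cong_right) (auto simp: x_def)
    also have "\<dots> = (\<Sum>l\<in>e ` I. if l = m then coeff f l else 0)"
      using I(2) by (simp add: sum.reindex)
    also have "\<dots> = (if m \<in> e ` I then coeff f m else 0)" using fin by simp
    also have "\<dots> = coeff f m" using assms[of m] I(3) by auto
    finally show ?thesis by simp
  qed
  then show ?thesis by (intro that[of x] poly_eqI)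
qed

lemma coeff_sum_monom_image:
  fixes e :: "nat \<Rightarrow> nat"
  assumes "coeff (\<Sum>i<N. monom (x i) (e i)) m \<noteq> 0"
  shows "m \<in> e ` {..<N}"
proof (rule ccontr)
  assume "m \<notin> e ` {..<N}"
  then have "coeff (\<Sum>i<N. monom (x i) (e i)) m = 0"
    unfolding coeff_sum by (intro sum.neutral) auto
  then show False using assms by simp
qed

lemma pos_semidef_iff_poly:
  "pos_semidef (Matrix.mat N N (\<lambda>(i, j). g (e i + e j))) \<longleftrightarrow>
    (\<forall>f. (\<forall>m. coeff f m \<noteq> 0 \<longrightarrow> m \<in> e ` {..<N}) \<longrightarrow> riesz g (f * f) \<ge> 0)"
  unfolding pos_semidef_iff_riesz
proof (intro iffI allI impI)
  fix f :: "real poly"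
  assume x: "\<forall>x. riesz g ((\<Sum>i<N. monom (x i) (e i)) * (\<Sum>i<N. monom (x i) (e i))) \<ge> 0"
    and f: "\<forall>m. coeff f m \<noteq> 0 \<longrightarrow> m \<in> e ` {..<N}"
  from f obtain x where "f = (\<Sum>i<N. monom (x i) (e i))" using poly_eq_sum_monom_image by metis
  then show "riesz g (f * f) \<ge> 0" using x by simp
next
  fix x
  assume f: "\<forall>f. (\<forall>m. coeff f m \<noteq> 0 \<longrightarrow> m \<in> e ` {..<N}) \<longrightarrow> riesz g (f * f) \<ge> 0"
  show "riesz g ((\<Sum>i<N. monom (x i) (e i)) * (\<Sum>i<N. monom (x i) (e i))) \<ge> 0"
    by (rule f[rule_format]) (rule coeff_sum_monom_image)
qed

text \<open>With a repeated exponent a nonzero vector could represent the zero polynomial, which is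
  why injectivity is assumed here although the semidefinite version holds without it.\<close>

lemma pos_def_iff_poly:
  assumes inj: "inj_on e {..<N}"
  shows "pos_def (Matrix.mat N N (\<lambda>(i, j). g (e i + e j))) \<longleftrightarrow>
    (\<forall>f. f \<noteq> 0 \<and> (\<forall>m. coeff f m \<noteq> 0 \<longrightarrow> m \<in> e ` {..<N}) \<longrightarrow> riesz g (f * f) > 0)"
  unfolding pos_def_iff_riesz
proof (intro iffI allI impI)
  fix f :: "real poly"
  assume x: "\<forall>x. (\<exists>i<N. x i \<noteq> 0) \<longrightarrow> riesz g ((\<Sum>i<N. monom (x i) (e i)) * (\<Sum>i<N. monom (x i) (e i))) > 0"
    and f: "f \<noteq> 0 \<and> (\<forall>m. coeff f m \<noteq> 0 \<longrightarrow> m \<in> e ` {..<N})"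
  from f obtain x where fx: "f = (\<Sum>i<N. monom (x i) (e i))" using poly_eq_sum_monom_image by metis
  have "\<exists>i<N. x i \<noteq> 0"
  proof (rule ccontr)
    assume "\<not> ?thesis"
    then have "f = 0" unfolding fx by (intro sum.neutral) auto
    then show False using f by simp
  qed
  then show "riesz g (f * f) > 0" using x fx by simp
next
  fix x :: "nat \<Rightarrow> real"
  assume f: "\<forall>f. f \<noteq> 0 \<and> (\<forall>m. coeff f m \<noteq> 0 \<longrightarrow> m \<in> e ` {..<N}) \<longrightarrow> riesz g (f * f) > 0"
    and "\<exists>i<N. x i \<noteq> 0"
  then obtain i where i: "i < N" "x i \<noteq> 0" by blast
  have "coeff (\<Sum>l<N. monom (x l) (e l)) (e i) = (\<Sum>l<N. if l = i then x l else 0)"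
    unfolding coeff_sum using inj i(1) by (intro sum.cong) (auto dest: inj_onD)
  then have "coeff (\<Sum>l<N. monom (x l) (e l)) (e i) \<noteq> 0" using i by simp
  then have "(\<Sum>l<N. monom (x l) (e l)) \<noteq> 0" by (metis coeff_0)
  then show "riesz g ((\<Sum>i<N. monom (x i) (e i)) * (\<Sum>i<N. monom (x i) (e i))) > 0"
    by (intro f[rule_format] conjI allI impI) (auto intro: coeff_sum_monom_image)
qed

context
  fixes k :: nat and \<beta> :: "nat \<Rightarrow> nat \<Rightarrow> real"
  assumes k: "k \<ge> 1"
begin

lemma hankel_tilde_exponents:
  "hankel (beta_tilde \<beta> k) = Matrix.mat (3 * k) (3 * k) (\<lambda>(i, j). cusp_seq \<beta> (Suc i + Suc j))"
  by (simp add: hankel_tilde[OF k])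

lemma image_Suc_support:
  "(\<forall>m. coeff f m \<noteq> 0 \<longrightarrow> m \<in> Suc ` {..<3 * k}) \<longleftrightarrow> degree f \<le> 3 * k \<and> coeff f 0 = (0::real)"
proof -
  have img: "m \<in> Suc ` {..<3 * k} \<longleftrightarrow> m \<noteq> 0 \<and> m \<le> 3 * k" for m
    by (cases m) auto
  show ?thesis
  proof
    assume *: "\<forall>m. coeff f m \<noteq> 0 \<longrightarrow> m \<in> Suc ` {..<3 * k}"
    have "degree f \<le> 3 * k"
      by (rule degree_le) (use * img in \<open>metis not_less\<close>)
    moreover have "coeff f 0 = 0" using *[rule_format, of 0] unfolding img by blast
    ultimately show "degree f \<le> 3 * k \<and> coeff f 0 = 0" by blast
  next
    assume *: "degree f \<le> 3 * k \<and> coeff f 0 = 0"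
    show "\<forall>m. coeff f m \<noteq> 0 \<longrightarrow> m \<in> Suc ` {..<3 * k}"
      unfolding img using * le_degree[of f] by (metis le_trans)
  qed
qed

lemma pos_def_hankel_tilde:
  "pos_def (hankel (beta_tilde \<beta> k)) \<longleftrightarrow>
    (\<forall>f. f \<noteq> 0 \<and> degree f \<le> 3 * k \<and> coeff f 0 = 0 \<longrightarrow> riesz (cusp_seq \<beta>) (f * f) > 0)"
  unfolding hankel_tilde_exponents by (subst pos_def_iff_poly) (simp_all only: image_Suc_support inj_Suc)

lemma pos_semidef_hankel_tilde:
  "pos_semidef (hankel (beta_tilde \<beta> k)) \<longleftrightarrow>
    (\<forall>f. degree f \<le> 3 * k \<and> coeff f 0 = 0 \<longrightarrow> riesz (cusp_seq \<beta>) (f * f) \<ge> 0)"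
  unfolding hankel_tilde_exponents by (subst pos_semidef_iff_poly) (simp only: image_Suc_support)

lemma pos_def_A_tilde:
  "pos_def (A_tilde \<beta> k) \<longleftrightarrow>
    (\<forall>f. f \<noteq> 0 \<and> degree f < 3 * k \<and> coeff f 1 = 0 \<longrightarrow> riesz (cusp_seq \<beta>) (f * f) > 0)"
proof -
  let ?e = "\<lambda>i::nat. if i = 0 then 0 else i + 1"
  have inj: "inj_on ?e {..<3 * k - 1}" by (auto simp: inj_on_def split: if_splits)
  have img: "m \<in> ?e ` {..<3 * k - 1} \<longleftrightarrow> m \<noteq> 1 \<and> m < 3 * k" for m
  proof
    assume "m \<noteq> 1 \<and> m < 3 * k"
    then have "m = ?e (m - 1)" "m - 1 < 3 * k - 1" using k by (simp, linarith)
    then show "m \<in> ?e ` {..<3 * k - 1}" by (simp only: image_eqI lessThan_iff)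
  qed (use k in auto)
  have "(\<forall>m. coeff f m \<noteq> 0 \<longrightarrow> m \<in> ?e ` {..<3 * k - 1}) \<longleftrightarrow> degree f < 3 * k \<and> coeff f 1 = 0" for f :: "real poly"
  proof
    assume *: "\<forall>m. coeff f m \<noteq> 0 \<longrightarrow> m \<in> ?e ` {..<3 * k - 1}"
    have "degree f \<le> 3 * k - 1"
    proof (rule degree_le, intro allI impI)
      fix i assume "3 * k - 1 < i"
      then have "\<not> i < 3 * k" by linarith
      then show "coeff f i = 0" using *[rule_format, of i] unfolding img by blast
    qed
    moreover have "coeff f 1 = 0" using *[rule_format, of 1] unfolding img by blast
    ultimately show "degree f < 3 * k \<and> coeff f 1 = 0" using k by simp
  next
    assume *: "degree f < 3 * k \<and> coeff f 1 = 0"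
    show "\<forall>m. coeff f m \<noteq> 0 \<longrightarrow> m \<in> ?e ` {..<3 * k - 1}"
      unfolding img using * le_degree[of f] by (metis le_less_trans)
  qed
  then show ?thesis unfolding A_tilde_eq[OF k]
    by (subst pos_def_iff_poly[OF inj]) (simp only: conj_assoc)
qed

end

section \<open>Monomials, columns of the moment matrix, and the relation y^2 = x^3\<close>

lemma set_monomials: "set (monomials k) = {(i, j). i + j \<le> k}"
proof -
  have "(i, j) \<in> set (monomials k) \<longleftrightarrow> i + j \<le> k" for i j
  proof
    assume "i + j \<le> k"
    then have "i + j \<in> {0..<Suc k}" by simp
    moreover have "(i, j) \<in> (\<lambda>l. (i + j - l, l)) ` {0..<Suc (i + j)}"
      by (rule image_eqI[of _ _ j]) simp_all
    ultimately show "(i, j) \<in> set (monomials k)"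
      unfolding monomials_def set_concat set_map set_upt image_image by (rule UN_I)
  qed (auto simp: monomials_def simp del: upt_Suc)
  then show ?thesis by auto
qed

lemma distinct_monomials: "distinct (monomials k)"
proof -
  let ?row = "\<lambda>d. map (\<lambda>j. (d - j, j)) [0..<Suc d]"
  have "distinct (map ?row [0..<Suc k])"
  proof -
    have "inj_on ?row {0..<Suc k}"
    proof (rule inj_onI)
      fix d e assume "?row d = ?row e"
      then have "length (?row d) = length (?row e)" by (rule arg_cong)
      then show "d = e" by (simp del: upt_Suc)
    qed
    then show ?thesis by (simp add: distinct_map del: upt_Suc)
  qed
  moreover have "set ys \<inter> set zs = {}"
    if yz: "ys \<in> set (map ?row [0..<Suc k])" "zs \<in> set (map ?row [0..<Suc k])" "ys \<noteq> zs" for ys zs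
  proof (rule ccontr)
    assume "set ys \<inter> set zs \<noteq> {}"
    then obtain i j where ij: "(i, j) \<in> set ys" "(i, j) \<in> set zs" by auto
    obtain d e where de: "ys = ?row d" "zs = ?row e" using yz(1,2) by (auto simp del: upt_Suc)
    have "i + j = d" "i + j = e" using ij de by (auto simp del: upt_Suc)
    then show False using yz(3) de by simp
  qed
  moreover have "distinct ys" if "ys \<in> set (map ?row [0..<Suc k])" for ys
    using that by (auto simp: distinct_map inj_on_def simp del: upt_Suc)
  ultimately show ?thesis unfolding monomials_def by (intro distinct_concat)
qed

lemma sum_monomials:
  "(\<Sum>c<length (monomials k). h (monomials k ! c)) = (\<Sum>(i, j)\<in>{(i, j). i + j \<le> k}. h (i, j))"
proof -
  have "(\<Sum>c<length (monomials k). h (monomials k ! c)) = sum_list (map h (monomials k))"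
    by (simp add: sum_list_sum_nth atLeast0LessThan)
  also have "\<dots> = sum h (set (monomials k))" by (rule sum_list_distinct_conv_sum_set[OF distinct_monomials])
  finally show ?thesis by (simp add: set_monomials case_prod_beta)
qed

lemma finite_degree_le: "finite {(i, j). i + j \<le> (k::nat)}"
  unfolding set_monomials[symmetric] by simp

lemma col_comb_index:
  assumes "r < length (monomials k)" "monomials k ! r = (a, b)"
  shows "col_comb \<beta> k p $ r =
    (\<Sum>(i, j)\<in>{(i, j). i + j \<le> k}. \<beta> (a + i) (b + j) * Poly_Mapping.lookup p (i, j))"
proof -
  have "col_comb \<beta> k p $ r = (\<Sum>c<length (monomials k).
      \<beta> (a + fst (monomials k ! c)) (b + snd (monomials k ! c)) * Poly_Mapping.lookup p (monomials k ! c))"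
    using assms by (simp add: col_comb_def moment_matrix_def scalar_prod_def atLeast0LessThan)
  then show ?thesis
    using sum_monomials[of "\<lambda>q. \<beta> (a + fst q) (b + snd q) * Poly_Mapping.lookup p q" k] by simp
qed

lemma col_comb_carrier: "col_comb \<beta> k p \<in> carrier_vec (length (monomials k))"
  unfolding col_comb_def by (intro carrier_vecI) (simp add: moment_matrix_def)

lemma col_comb_diff: "col_comb \<beta> k (p - q) = col_comb \<beta> k p - col_comb \<beta> k q"
proof (rule eq_vecI)
  fix r assume "r < dim_vec (col_comb \<beta> k p - col_comb \<beta> k q)"
  then have r: "r < length (monomials k)" using col_comb_carrier[of \<beta> k q] by simp
  obtain a b where ab: "monomials k ! r = (a, b)" by fastforce
  show "col_comb \<beta> k (p - q) $ r = (col_comb \<beta> k p - col_comb \<beta> k q) $ r"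
    using r col_comb_carrier[of \<beta> k q] col_comb_carrier[of \<beta> k p]
    by (simp add: col_comb_index[OF r ab] lookup_minus sum_subtractf right_diff_distrib case_prod_beta)
qed (use col_comb_carrier in \<open>simp add: carrier_vecD[OF col_comb_carrier]\<close>)

lemma col_comb_monom2:
  assumes "r < length (monomials k)" "monomials k ! r = (a, b)" "i + j \<le> k"
  shows "col_comb \<beta> k (monom2 i j) $ r = \<beta> (a + i) (b + j)"
proof -
  have "col_comb \<beta> k (monom2 i j) $ r =
      (\<Sum>q\<in>{(i, j). i + j \<le> k}. if q = (i, j) then \<beta> (a + i) (b + j) else 0)"
    unfolding col_comb_index[OF assms(1,2)]
    by (intro sum.cong) (auto simp: monom2_def lookup_single when_def split: if_splits)
  then show ?thesis using assms(3) finite_degree_le by simp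
qed

text \<open>For k at least 3, recursive generation multiplies the relation by monomials of degree up
  to k - 3, and the rows supply a further factor of degree up to k; together they reach all of
  degree 2k. For k = 2 the matrix has no column x^3, and the three given equalities are exactly the
  three instances.\<close>

lemma cusp_relation:
  assumes "recursively_generated \<beta> k" "cond1 \<beta> k" "i + j + 3 \<le> 2 * k"
  shows "\<beta> (i + 3) j = \<beta> i (j + 2)"
proof -
  consider "k \<ge> 3" "col_comb \<beta> k (monom2 0 2) = col_comb \<beta> k (monom2 3 0)"
    | "k = 2" "\<beta> 0 2 = \<beta> 3 0" "\<beta> 1 2 = \<beta> 4 0" "\<beta> 0 3 = \<beta> 3 1" | "k = 1"
    using assms(2) by (auto simp: cond1_def)
  then show ?thesis
  proof cases
    case 1
    \<comment> \<open>As much as possible of x^i y^j is taken as the multiplier of the relation, up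
      to degree k - 3; since i + j is at most 2k - 3, what remains has degree at most k and labels a
      row.\<close>
    define a c where "a = min i (k - 3)" and "c = min j (k - 3 - a)"
    have ac: "a \<le> i" "c \<le> j" "a + c + 3 \<le> k" "(i - a) + (j - c) \<le> k"
      using 1(1) assms(3) unfolding a_def c_def by linarith+
    let ?p = "monom2 0 2 - monom2 3 0" and ?q = "monom2 a c"
    have pq: "?p * ?q = monom2 a (c + 2) - monom2 (a + 3) c"
      by (simp add: monom2_def left_diff_distrib mult_single add.commute)
    have "deg_le ?p k" "deg_le ?q k" "deg_le (?p * ?q) k"
      using ac(3) unfolding pq deg_le_def
      by (auto simp: monom2_def dest!: subsetD[OF keys_diff] split: if_splits)
    moreover have "col_comb \<beta> k ?p = 0\<^sub>v (length (monomials k))"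
      using 1(2) col_comb_carrier by (simp add: col_comb_diff minus_cancel_vec)
    ultimately have zero: "col_comb \<beta> k (?p * ?q) = 0\<^sub>v (length (monomials k))"
      using assms(1) unfolding recursively_generated_def by blast
    have "(i - a, j - c) \<in> set (monomials k)" using ac(4) by (simp add: set_monomials)
    then obtain r where r: "r < length (monomials k)" "monomials k ! r = (i - a, j - c)"
      by (metis in_set_conv_nth)
    have "col_comb \<beta> k (?p * ?q) $ r = \<beta> (i - a + a) (j - c + (c + 2)) - \<beta> (i - a + (a + 3)) (j - c + c)"
      unfolding pq col_comb_diff using r ac(3) col_comb_carrier[of \<beta> k]
      by (simp add: col_comb_monom2 carrier_vecD[OF col_comb_carrier])
    then show ?thesis using zero r(1) ac by (simp add: add.assoc[symmetric])
  next
    case 2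
    then have "i + j \<le> 1" using assms(3) by simp
    then consider "i = 0" "j = 0" | "i = 1" "j = 0" | "i = 0" "j = 1" by linarith
    then show ?thesis by cases (use 2 in \<open>simp_all add: numeral_eq_Suc\<close>)
  qed (use assms(3) in simp)
qed

definition monomial_exponent :: "nat \<Rightarrow> nat \<Rightarrow> nat" where
  "monomial_exponent k r = 2 * fst (monomials k ! r) + 3 * snd (monomials k ! r)"

text \<open>The semigroup generated by 2 and 3 misses only 1. Taking i at most 2 keeps the degree i
  + j within the bound.\<close>

lemma exponent_representation:
  assumes "m \<noteq> 1" "m \<le> 3 * l" "l \<ge> 1"
  obtains i j where "i + j \<le> l" "2 * i + 3 * j = (m::nat)"
proof -
  define q where "q = m div 3"
  have m: "m = 3 * q + m mod 3" by (simp add: q_def)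
  consider "m mod 3 = 0" | "m mod 3 = 1" | "m mod 3 = 2" by linarith
  then show ?thesis
  proof cases
    case 1
    then show ?thesis using that[of 0 q] assms m by simp
  next
    case 2
    then have "q \<ge> 1" using assms(1) m by (cases q) auto
    then show ?thesis using that[of 2 "q - 1"] assms m 2 by simp
  next
    case 3
    then show ?thesis using that[of 1 q] assms m by simp
  qed
qed

lemma image_monomial_exponent:
  assumes "k \<ge> 1"
  shows "monomial_exponent k ` {..<length (monomials k)} = {m. m \<noteq> 1 \<and> m \<le> 3 * k}"
proof -
  have "monomial_exponent k ` {..<length (monomials k)} = (\<lambda>(i, j). 2 * i + 3 * j) ` set (monomials k)"
    unfolding set_conv_nth monomial_exponent_def by (auto simp: case_prod_beta image_iff)
  also have "\<dots> = {m. m \<noteq> 1 \<and> m \<le> 3 * k}"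
  proof
    show "(\<lambda>(i, j). 2 * i + 3 * j) ` set (monomials k) \<subseteq> {m. m \<noteq> 1 \<and> m \<le> 3 * k}"
      by (auto simp: set_monomials) presburger
    show "{m. m \<noteq> 1 \<and> m \<le> 3 * k} \<subseteq> (\<lambda>(i, j). 2 * i + 3 * j) ` set (monomials k)"
    proof
      fix m assume "m \<in> {m. m \<noteq> 1 \<and> m \<le> 3 * k}"
      then obtain i j where "i + j \<le> k" "2 * i + 3 * j = m"
        using exponent_representation[of m k] assms by blast
      then show "m \<in> (\<lambda>(i, j). 2 * i + 3 * j) ` set (monomials k)"
        unfolding set_monomials by (intro image_eqI[of _ _ "(i, j)"]) simp_all
    qed
  qed
  finally show ?thesis .
qed

lemma moment_matrix_eq:
  assumes "\<And>i j. i + j \<le> 2 * k \<Longrightarrow> \<beta> i j = g (2 * i + 3 * j)"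
  shows "moment_matrix \<beta> k = Matrix.mat (length (monomials k)) (length (monomials k))
    (\<lambda>(r, c). g (monomial_exponent k r + monomial_exponent k c))"
proof -
  have "fst (monomials k ! r) + snd (monomials k ! r) \<le> k" if "r < length (monomials k)" for r
    using nth_mem[OF that] by (auto simp: set_monomials)
  from this this have "fst (monomials k ! r) + fst (monomials k ! c) + (snd (monomials k ! r) + snd (monomials k ! c)) \<le> 2 * k"
    if "r < length (monomials k)" "c < length (monomials k)" for r c
    using that by (smt (verit) add.commute add.left_commute add_mono mult_2)
  then show ?thesis unfolding moment_matrix_def monomial_exponent_def
    by (intro eq_matI) (simp_all add: assms algebra_simps)
qed

lemma coeff_support_iff:
  "(\<forall>m. coeff f m \<noteq> (0::real) \<longrightarrow> m \<in> {m. m \<noteq> 1 \<and> m \<le> N}) \<longleftrightarrow> degree f \<le> N \<and> coeff f 1 = 0"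
proof
  assume *: "\<forall>m. coeff f m \<noteq> 0 \<longrightarrow> m \<in> {m. m \<noteq> 1 \<and> m \<le> N}"
  have "degree f \<le> N" by (rule degree_le) (use * in force)
  then show "degree f \<le> N \<and> coeff f 1 = 0" using * by blast
next
  assume "degree f \<le> N \<and> coeff f 1 = 0"
  then show "\<forall>m. coeff f m \<noteq> 0 \<longrightarrow> m \<in> {m. m \<noteq> 1 \<and> m \<le> N}"
    using le_degree[of f] le_trans by blast
qed

lemma pos_semidef_moment_matrix:
  assumes "k \<ge> 1" "\<And>i j. i + j \<le> 2 * k \<Longrightarrow> \<beta> i j = g (2 * i + 3 * j)"
  shows "pos_semidef (moment_matrix \<beta> k) \<longleftrightarrow>
    (\<forall>f. degree f \<le> 3 * k \<and> coeff f 1 = 0 \<longrightarrow> riesz g (f * f) \<ge> 0)"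
proof -
  have "moment_matrix \<beta> k = Matrix.mat (length (monomials k)) (length (monomials k))
      (\<lambda>(r, c). g (monomial_exponent k r + monomial_exponent k c))"
    by (rule moment_matrix_eq) (rule assms(2))
  then show ?thesis
    by (simp only: pos_semidef_iff_poly image_monomial_exponent[OF assms(1)] coeff_support_iff)
qed

section \<open>Measures on the cusp\<close>

lemma closed_cusp_curve: "closed cusp_curve"
proof -
  have "cusp_curve = {p. snd p ^ 2 = fst p ^ 3}" by (auto simp: cusp_curve_def)
  also have "closed \<dots>" by (intro closed_Collect_eq continuous_intros)
  finally show ?thesis .
qed

lemma cusp_curve_measurable [measurable]: "cusp_curve \<in> sets borel"
  using closed_cusp_curve by (rule borel_closed)

lemma inj_cusp_parametrization: "inj (\<lambda>s::real. (s ^ 2, s ^ 3))"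
proof (rule injI)
  fix s t :: real assume "(s ^ 2, s ^ 3) = (t ^ 2, t ^ 3)"
  then have "s ^ 3 = t ^ 3" by simp
  then show "s = t" by (metis odd_real_root_power_cancel odd_numeral)
qed

text \<open>The measure is the image of a weighted point measure under t |-> (t^2, t^3). This map is
  injective, so the number of atoms is kept and the weights transfer.\<close>

lemma atoms_representing_measure:
  assumes fin: "finite S" and w: "\<And>s. s \<in> S \<Longrightarrow> w s > 0"
    and \<beta>: "\<And>i j. i + j \<le> 2 * k \<Longrightarrow> \<beta> i j = (\<Sum>s\<in>S. w s * s ^ (2 * i + 3 * j))"
  shows "\<exists>\<mu>. representing_measure \<beta> k cusp_curve \<mu> \<and> atomic_measure (card S) \<mu>"
proof -
  define pt where "pt s = (s ^ 2, s ^ 3)" for s :: real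
  define P where "P = point_measure S (\<lambda>s. ennreal (w s))"
  define \<mu> where "\<mu> = distr P (borel :: (real \<times> real) measure) pt"
  have inj: "inj pt" using inj_cusp_parametrization by (simp add: pt_def[abs_def])
  have pt_in: "pt s \<in> cusp_curve" for s by (simp add: pt_def cusp_curve_def flip: power_mult)
  have meas: "pt \<in> measurable P borel" by (simp add: P_def)
  have sets: "sets \<mu> = sets borel" by (simp add: \<mu>_def)
  have emeasure: "emeasure \<mu> A = (\<Sum>s\<in>S. ennreal (w s) * indicator A (pt s))" if "A \<in> sets borel" for A
  proof -
    have "emeasure \<mu> A = emeasure P (pt -` A \<inter> S)"
      unfolding \<mu>_def using that meas by (subst emeasure_distr) (simp_all add: P_def space_point_measure)
    also have "\<dots> = (\<Sum>s\<in>pt -` A \<inter> S. ennreal (w s))"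
      unfolding P_def using fin by (subst emeasure_point_measure_finite) auto
    also have "\<dots> = (\<Sum>s\<in>S. ennreal (w s) * indicator A (pt s))"
      using fin by (intro sum.mono_neutral_cong_left) (auto simp: indicator_def)
    finally show ?thesis .
  qed
  have supp: "msupport \<mu> \<subseteq> cusp_curve"
  proof
    fix p assume p: "p \<in> msupport \<mu>"
    show "p \<in> cusp_curve"
    proof (rule ccontr)
      assume "p \<notin> cusp_curve"
      moreover have "open (- cusp_curve)" using closed_cusp_curve by (simp add: open_Compl)
      ultimately have "emeasure \<mu> (- cusp_curve) > 0" using p unfolding msupport_def by blast
      moreover have "emeasure \<mu> (- cusp_curve) = 0"
        using pt_in \<open>open (- cusp_curve)\<close> by (subst emeasure) (auto simp: indicator_def)
      ultimately show False by simp
    qed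
  qed
  have int: "set_integrable \<mu> cusp_curve (\<lambda>(x, y). x ^ i * y ^ j)"
    and val: "set_lebesgue_integral \<mu> cusp_curve (\<lambda>(x, y). x ^ i * y ^ j) = (\<Sum>s\<in>S. w s * s ^ (2 * i + 3 * j))" for i j
  proof -
    have [measurable]: "(\<lambda>(x, y). x ^ i * y ^ j) \<in> borel_measurable (borel :: (real \<times> real) measure)"
      unfolding case_prod_beta by (intro borel_measurable_continuous_onI continuous_intros)
    have F: "(\<lambda>p. indicator cusp_curve p *\<^sub>R (case p of (x, y) \<Rightarrow> x ^ i * y ^ j)) \<in> borel_measurable (borel :: (real \<times> real) measure)"
      by measurable
    have Fpt: "indicator cusp_curve (pt s) * (case pt s of (x, y) \<Rightarrow> x ^ i * y ^ j) = s ^ (2 * i + 3 * j)" for s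
      using pt_in[of s] by (simp add: pt_def power_add power_mult)
    show "set_integrable \<mu> cusp_curve (\<lambda>(x, y). x ^ i * y ^ j)"
      unfolding set_integrable_def \<mu>_def using meas F fin
      by (subst integrable_distr_eq) (simp_all add: P_def integrable_point_measure_finite)
    show "set_lebesgue_integral \<mu> cusp_curve (\<lambda>(x, y). x ^ i * y ^ j) = (\<Sum>s\<in>S. w s * s ^ (2 * i + 3 * j))"
      unfolding set_lebesgue_integral_def \<mu>_def using fin w
      by (subst integral_distr[OF meas F]) (simp add: P_def lebesgue_integral_point_measure_finite less_imp_le Fpt)
  qed
  have "representing_measure \<beta> k cusp_curve \<mu>"
    unfolding representing_measure_def using sets supp int val \<beta> by simp
  moreover have "atomic_measure (card S) \<mu>"
    unfolding atomic_measure_def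
  proof (intro exI conjI ballI)
    show "finite (pt ` S)" using fin by simp
    show "card (pt ` S) = card S" using inj by (meson card_image inj_on_subset subset_UNIV)
    show "w (inv_into UNIV pt q) > 0" if "q \<in> pt ` S" for q using that w inj by auto
    show "emeasure \<mu> A = (\<Sum>q\<in>pt ` S. ennreal (w (inv_into UNIV pt q)) * indicator A q)" if "A \<in> sets borel" for A
    proof -
      have "inj_on pt S" using inj by (rule inj_on_subset) simp
      then show ?thesis using emeasure[OF that] inj by (simp add: sum.reindex)
    qed
  qed (fact sets)
  ultimately show ?thesis by blast
qed

section \<open>Measures on the cusp in the parameter t = root 3 y, and the necessity of the
  conditions\<close>

lemma cusp_curve_parameter:
  assumes "p \<in> cusp_curve"
  shows "fst p = root 3 (snd p) ^ 2" "snd p = root 3 (snd p) ^ 3"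
proof -
  let ?t = "root 3 (snd p)"
  show y: "snd p = ?t ^ 3" by (simp add: odd_real_root_pow)
  have "fst p ^ 3 = snd p ^ 2" using assms by (auto simp: cusp_curve_def)
  also have "snd p ^ 2 = (?t ^ 3) ^ 2" by (rule arg_cong[OF y])
  also have "\<dots> = (?t ^ 2) ^ 3" by (simp flip: power_mult)
  finally show "fst p = ?t ^ 2" by (metis odd_real_root_power_cancel odd_numeral)
qed

lemma representing_measure_parameter:
  assumes k: "k \<ge> 1" and \<mu>: "representing_measure \<beta> k cusp_curve \<mu>"
  defines "\<tau> \<equiv> \<lambda>p :: real \<times> real. root 3 (snd p)"
  shows "m \<le> 6 * k \<Longrightarrow> integrable \<mu> (\<lambda>p. indicator cusp_curve p * \<tau> p ^ m)"
    and "i + j \<le> 2 * k \<Longrightarrow> \<beta> i j = (\<integral>p. indicator cusp_curve p * \<tau> p ^ (2 * i + 3 * j) \<partial>\<mu>)"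
proof -
  have sets: "sets \<mu> = sets borel" using \<mu> by (simp add: representing_measure_def)
  have eq: "indicator cusp_curve p *\<^sub>R (case p of (x, y) \<Rightarrow> x ^ i * y ^ j) =
      indicator cusp_curve p * \<tau> p ^ (2 * i + 3 * j)" for p i j
  proof (cases "p \<in> cusp_curve")
    case True
    have "(case p of (x, y) \<Rightarrow> x ^ i * y ^ j) = fst p ^ i * snd p ^ j" by (simp add: case_prod_beta)
    also have "\<dots> = (\<tau> p ^ 2) ^ i * (\<tau> p ^ 3) ^ j"
      using cusp_curve_parameter[OF True] unfolding \<tau>_def by metis
    finally show ?thesis using True by (simp add: power_add power_mult)
  qed simp
  have int: "integrable \<mu> (\<lambda>p. indicator cusp_curve p * \<tau> p ^ (2 * i + 3 * j))"
    and val: "\<beta> i j = (\<integral>p. indicator cusp_curve p * \<tau> p ^ (2 * i + 3 * j) \<partial>\<mu>)"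
    if "i + j \<le> 2 * k" for i j
    using \<mu> that unfolding representing_measure_def set_integrable_def set_lebesgue_integral_def eq by blast+
  show "i + j \<le> 2 * k \<Longrightarrow> \<beta> i j = (\<integral>p. indicator cusp_curve p * \<tau> p ^ (2 * i + 3 * j) \<partial>\<mu>)" by (rule val)
  assume m: "m \<le> 6 * k"
  show "integrable \<mu> (\<lambda>p. indicator cusp_curve p * \<tau> p ^ m)"
  proof (cases "m = 1")
    case False
    then obtain i j where "i + j \<le> 2 * k" "2 * i + 3 * j = m"
      using exponent_representation[of m "2 * k"] m k by auto
    then show ?thesis using int by blast
  next
    case True
    \<comment> \<open>The first power of the parameter is no monomial in x and y, so its
      integrability is not part of the hypothesis; it follows from domination by 1 + t^2.\<close>
    have "integrable \<mu> (\<lambda>p. indicator cusp_curve p * \<tau> p ^ 0 + indicator cusp_curve p * \<tau> p ^ 2)"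
      using int[of 0 0] int[of 1 0] k by (intro Bochner_Integration.integrable_add) simp_all
    then show ?thesis
    proof (rule Bochner_Integration.integrable_bound)
      have [measurable]: "\<tau> \<in> borel_measurable \<mu>"
        unfolding \<tau>_def measurable_cong_sets[OF sets refl]
        by (intro borel_measurable_continuous_onI continuous_intros)
      have [measurable]: "cusp_curve \<in> sets \<mu>" using sets cusp_curve_measurable by simp
      show "(\<lambda>p. indicator cusp_curve p * \<tau> p ^ m) \<in> borel_measurable \<mu>" by measurable
      have "\<bar>t\<bar> \<le> 1 + t ^ 2" for t :: real
        using sum_squares_bound[of 1 "\<bar>t\<bar>"] by (simp add: power2_eq_square) 
      then show "AE p in \<mu>. norm (indicator cusp_curve p * \<tau> p ^ m) \<le>
          norm (indicator cusp_curve p * \<tau> p ^ 0 + indicator cusp_curve p * \<tau> p ^ 2)"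
        unfolding True by (intro AE_I2) (auto simp: indicator_def)
    qed
  qed
qed

text \<open>The measure supplies a moment of t, so its moments \<open>\<gamma>\<close> give a form
  that is semidefinite on all polynomials of degree at most 3k. The dichotomy between (a) and (b) is
  whether the form of \<open>beta_tilde\<close> is definite. If it is not, a null vector confines
  the measure to finitely many parameters, and all three ranks count those of them that are nonzero
  and carry mass.\<close>

lemma representing_measure_imp_conditions:
  assumes k: "k \<ge> 1" and \<mu>: "representing_measure \<beta> k cusp_curve \<mu>"
  shows "cond1 \<beta> k" and "cond2a \<beta> k \<or> cond2b \<beta> k"
proof -
  define \<tau> where "\<tau> p = root 3 (snd p)" for p :: "real \<times> real"
  define I where "I p = (indicator cusp_curve p :: real)" for p
  define \<gamma> where "\<gamma> m = (\<integral>p. I p * \<tau> p ^ m \<partial>\<mu>)" for m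
  have int: "integrable \<mu> (\<lambda>p. I p * \<tau> p ^ m)" if "m \<le> 6 * k" for m
    using representing_measure_parameter(1)[OF k \<mu> that] by (simp add: \<tau>_def I_def)
  have \<beta>: "\<beta> i j = \<gamma> (2 * i + 3 * j)" if "i + j \<le> 2 * k" for i j
    using representing_measure_parameter(2)[OF k \<mu> that] by (simp add: \<gamma>_def \<tau>_def I_def)
  show "cond1 \<beta> k"
  proof -
    consider "k = 1" | "k = 2" | "k \<ge> 3" using k by linarith
    then show ?thesis
    proof cases
      case 3
      have "col_comb \<beta> k (monom2 0 2) = col_comb \<beta> k (monom2 3 0)"
      proof (rule eq_vecI)
        fix r assume "r < dim_vec (col_comb \<beta> k (monom2 3 0))"
        then have r: "r < length (monomials k)" by (simp add: carrier_vecD[OF col_comb_carrier])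
        obtain a b where ab: "monomials k ! r = (a, b)" by fastforce
        then have "a + b \<le> k" using nth_mem[OF r] by (simp add: set_monomials)
        then have "\<beta> (a + 0) (b + 2) = \<beta> (a + 3) (b + 0)"
          using 3 by (subst (1 2) \<beta>) (simp_all add: algebra_simps)
        then show "col_comb \<beta> k (monom2 0 2) $ r = col_comb \<beta> k (monom2 3 0) $ r"
          using 3 by (simp add: col_comb_monom2[OF r ab])
      qed (simp add: carrier_vecD[OF col_comb_carrier])
      then show ?thesis using 3 by (simp add: cond1_def)
    qed (simp_all add: cond1_def \<beta>)
  qed
  have G: "cusp_seq \<beta> m = \<gamma> m" if m: "m \<noteq> 1" "m \<le> 6 * k" for m
  proof -
    have "m \<le> 3 * (2 * k)" "2 * k \<ge> 1" using m k by simp_all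
    then obtain i j where ij: "i + j \<le> 2 * k" "2 * i + 3 * j = m"
      by (rule exponent_representation[OF m(1)])
    have "\<beta> i j = cusp_seq \<beta> (2 * i + 3 * j)"
      by (rule cusp_seq_eq[OF _ ij(1)]) (simp add: \<beta> algebra_simps)
    then show ?thesis using \<beta> ij by simp
  qed
  have riesz_int: "integrable \<mu> (\<lambda>p. I p * poly f (\<tau> p))"
    and riesz_eq: "riesz \<gamma> f = (\<integral>p. I p * poly f (\<tau> p) \<partial>\<mu>)" if "degree f \<le> 6 * k" for f
  proof -
    have eq: "I p * poly f (\<tau> p) = (\<Sum>i\<le>degree f. coeff f i * (I p * \<tau> p ^ i))" for p
      by (simp add: poly_altdef sum_distrib_left mult_ac)
    have int': "integrable \<mu> (\<lambda>p. coeff f i * (I p * \<tau> p ^ i))" if "i \<in> {..degree f}" for i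
      using that \<open>degree f \<le> 6 * k\<close> by (intro integrable_mult_right int) simp
    show "integrable \<mu> (\<lambda>p. I p * poly f (\<tau> p))"
      unfolding eq by (rule Bochner_Integration.integrable_sum[OF int'])
    show "riesz \<gamma> f = (\<integral>p. I p * poly f (\<tau> p) \<partial>\<mu>)"
      unfolding eq by (subst Bochner_Integration.integral_sum[OF int']) (simp_all add: riesz_def \<gamma>_def)
  qed
  have sq: "degree (f * f) \<le> 6 * k" if "degree f \<le> 3 * k" for f :: "real poly"
    using degree_mult_le[of f f] that by simp
  have nonneg: "I p * poly (f * f) (\<tau> p) \<ge> 0" for f p by (simp add: I_def)
  have psd: "riesz \<gamma> (f * f) \<ge> 0" if "degree f \<le> 3 * k" for f
    unfolding riesz_eq[OF sq[OF that]] using nonneg by (rule Bochner_Integration.integral_nonneg)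
  have null: "AE p in \<mu>. I p * poly f (\<tau> p) = 0" if "degree f \<le> 3 * k" "riesz \<gamma> (f * f) = 0" for f
  proof -
    have "AE p in \<mu>. I p * poly (f * f) (\<tau> p) = 0"
      using that(2) nonneg riesz_int[OF sq[OF that(1)]] unfolding riesz_eq[OF sq[OF that(1)]]
      by (subst (asm) integral_nonneg_eq_0_iff_AE) auto
    then show ?thesis by eventually_elim auto
  qed
  \<comment> \<open>The two sequences may differ at 1, but f * f has no linear term under either
    alternative.\<close>
  have riesz_G: "riesz (cusp_seq \<beta>) (f * f) = riesz \<gamma> (f * f)"
    if "degree f \<le> 3 * k" "coeff f 0 = 0 \<or> coeff f 1 = 0" for f
  proof (rule riesz_cong)
    fix i assume i: "i \<le> degree (f * f)" "coeff (f * f) i \<noteq> 0"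
    have "coeff (f * f) 1 = 0" using that(2) by (auto simp: coeff_mult atMost_Suc)
    then show "cusp_seq \<beta> i = \<gamma> i" using i sq[OF that(1)] by (intro G) auto
  qed
  show "cond2a \<beta> k \<or> cond2b \<beta> k"
  proof (cases "pos_def (hankel (beta_tilde \<beta> k))")
    case True
    have "pos_def (A_tilde \<beta> k)"
      unfolding pos_def_A_tilde[OF k]
    proof (intro allI impI, rule ccontr)
      fix f assume f: "f \<noteq> 0 \<and> degree f < 3 * k \<and> coeff f 1 = 0"
        and "\<not> riesz (cusp_seq \<beta>) (f * f) > 0"
      then have "riesz \<gamma> (f * f) = 0" using psd[of f] riesz_G[of f] by simp
      then have AE0: "AE p in \<mu>. I p * poly f (\<tau> p) = 0" using f by (intro null) simp_all
      \<comment> \<open>The strict degree bound on \<open>f\<close> leaves room for the factor t, so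
        the product falls under the definite form on t, ..., t^(3k).\<close>
      let ?h = "f * monom 1 1"
      have dh: "degree ?h \<le> 3 * k" using f by (simp add: degree_mult_eq degree_monom_eq)
      have h0: "coeff ?h 0 = 0" by (simp add: coeff_mult)
      have "riesz \<gamma> (?h * ?h) = (\<integral>p. I p * poly (?h * ?h) (\<tau> p) \<partial>\<mu>)" by (rule riesz_eq[OF sq[OF dh]])
      also have "\<dots> = (\<integral>p. 0 \<partial>\<mu>)"
      proof (rule integral_cong_AE)
        show "(\<lambda>p. I p * poly (?h * ?h) (\<tau> p)) \<in> borel_measurable \<mu>"
          using riesz_int[OF sq[OF dh]] by (rule borel_measurable_integrable)
        show "AE p in \<mu>. I p * poly (?h * ?h) (\<tau> p) = 0" using AE0 by eventually_elim auto
      qed simp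
      finally have "riesz (cusp_seq \<beta>) (?h * ?h) = 0" using riesz_G[OF dh] h0 by simp
      moreover have "riesz (cusp_seq \<beta>) (?h * ?h) > 0"
        using True f dh h0 unfolding pos_def_hankel_tilde[OF k] by simp
      ultimately show False by simp
    qed
    then show ?thesis using True by (simp add: cond2a_def)
  next
    case False
    then obtain f where f: "f \<noteq> 0" "degree f \<le> 3 * k" "coeff f 0 = 0" "\<not> riesz (cusp_seq \<beta>) (f * f) > 0"
      unfolding pos_def_hankel_tilde[OF k] by blast
    then have "riesz \<gamma> (f * f) = 0" using psd[of f] riesz_G[of f] by simp
    then have AE0: "AE p in \<mu>. I p * poly f (\<tau> p) = 0" using f by (intro null)
    \<comment> \<open>Since f(0) = 0, removing the root 0 leaves at most 3k - 1 parameters, which is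
      small enough for the rank count in the matrices with 3k - 1 rows. A mass at 0 contributes to
      no moment of positive order.\<close>
    define Z where "Z = {s. poly f s = 0} - {0}"
    have finf: "finite {s. poly f s = 0}" using f(1) by (rule poly_roots_finite)
    then have fin: "finite Z" by (simp add: Z_def)
    have "poly f 0 = 0" using f(3) by (simp add: poly_0_coeff_0)
    then have "card Z < card {s. poly f s = 0}" unfolding Z_def using finf by (intro card_Diff1_less) auto
    also have "\<dots> \<le> 3 * k" using card_poly_roots_bound[OF f(1)] f(2) by simp
    finally have cardZ: "card Z \<le> 3 * k - 1" by simp
    \<comment> \<open>\<open>E s\<close> is the indicator of the single point of the cusp with
      parameter s, and \<open>w s\<close> is its mass.\<close>
    define E where "E s p = I p * (if \<tau> p = s then 1 else 0)" for s p
    define w where "w s = (\<integral>p. E s p \<partial>\<mu>)" for s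
    have sets: "sets \<mu> = sets borel" using \<mu> by (simp add: representing_measure_def)
    have E_int: "integrable \<mu> (E s)" for s
    proof (rule Bochner_Integration.integrable_bound)
      show "integrable \<mu> (\<lambda>p. I p * \<tau> p ^ 0)" by (rule int) simp
      have [measurable]: "\<tau> \<in> borel_measurable \<mu>"
        unfolding \<tau>_def[abs_def] measurable_cong_sets[OF sets refl]
        by (intro borel_measurable_continuous_onI continuous_intros)
      have [measurable]: "cusp_curve \<in> sets \<mu>" using sets cusp_curve_measurable by simp
      show "E s \<in> borel_measurable \<mu>" unfolding E_def[abs_def] I_def[abs_def] by measurable
    qed (auto simp: E_def)
    have \<gamma>_eq: "\<gamma> m = (\<Sum>s\<in>Z. w s * s ^ m)" if m: "m \<noteq> 0" "m \<le> 6 * k" for m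
    proof -
      have "\<gamma> m = (\<integral>p. (\<Sum>s\<in>Z. E s p * s ^ m) \<partial>\<mu>)"
        unfolding \<gamma>_def
      proof (rule integral_cong_AE)
        show "(\<lambda>p. I p * \<tau> p ^ m) \<in> borel_measurable \<mu>"
          using int[OF m(2)] by (rule borel_measurable_integrable)
        show "(\<lambda>p. \<Sum>s\<in>Z. E s p * s ^ m) \<in> borel_measurable \<mu>"
          using E_int by (intro borel_measurable_integrable Bochner_Integration.integrable_sum integrable_mult_left)
        show "AE p in \<mu>. I p * \<tau> p ^ m = (\<Sum>s\<in>Z. E s p * s ^ m)"
          using AE0
        proof eventually_elim
          case (elim p)
          have "(\<Sum>s\<in>Z. E s p * s ^ m) = (\<Sum>s\<in>Z. if s = \<tau> p then I p * s ^ m else 0)"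
            by (intro sum.cong) (auto simp: E_def)
          also have "\<dots> = (if \<tau> p \<in> Z then I p * \<tau> p ^ m else 0)" using fin by simp
          also have "\<dots> = I p * \<tau> p ^ m" using elim m(1) by (auto simp: Z_def power_0_left)
          finally show ?case by simp
        qed
      qed
      also have "\<dots> = (\<Sum>s\<in>Z. \<integral>p. E s p * s ^ m \<partial>\<mu>)"
        using E_int by (intro Bochner_Integration.integral_sum integrable_mult_left)
      also have "\<dots> = (\<Sum>s\<in>Z. w s * s ^ m)" by (simp add: w_def)
      finally show ?thesis .
    qed
    define S where "S = {s \<in> Z. w s \<noteq> 0}"
    have finS: "finite S" and cardS: "card S \<le> 3 * k - 1"
      using fin cardZ card_mono[of Z S] by (auto simp: S_def)
    have G_eq: "cusp_seq \<beta> (m + d) = (\<Sum>s\<in>S. w s * s ^ d * s ^ m)" if "m + d \<le> 6 * k" "d \<ge> 2" for m d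
    proof -
      have "cusp_seq \<beta> (m + d) = (\<Sum>s\<in>Z. w s * s ^ (m + d))" using that by (simp add: G \<gamma>_eq)
      also have "\<dots> = (\<Sum>s\<in>S. w s * s ^ (m + d))"
        using fin by (intro sum.mono_neutral_right) (auto simp: S_def)
      finally show ?thesis by (simp add: power_add mult_ac)
    qed
    have wS: "w s * s ^ d \<noteq> 0" if "s \<in> S" for s d using that by (auto simp: S_def Z_def)
    have "mat_rank (hankel (beta_hat \<beta> k)) = card S"
      unfolding hankel_hat[OF k]
      by (intro mat_rank_hankel_form_atoms[where w = "\<lambda>s. w s * s ^ 2"] G_eq wS finS)
        (use cardS k in linarith)+
    moreover have "mat_rank (hankel (beta_tilde \<beta> k)) = card S"
      unfolding hankel_tilde[OF k]
      by (intro mat_rank_hankel_form_atoms[where w = "\<lambda>s. w s * s ^ 2"] G_eq wS finS)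
        (use cardS k in linarith)+
    moreover have "mat_rank (hankel (beta_breve \<beta> k)) = card S"
      unfolding hankel_breve[OF k]
      by (intro mat_rank_hankel_form_atoms[where w = "\<lambda>s. w s * s ^ 4"] G_eq wS finS)
        (use cardS k in linarith)+
    moreover have "pos_semidef (hankel (beta_tilde \<beta> k))"
      unfolding pos_semidef_hankel_tilde[OF k] using psd riesz_G by simp
    ultimately show ?thesis by (simp add: cond2b_def)
  qed
qed

section \<open>Existence of atomic measures\<close>

lemma length_beta_tilde: "k \<ge> 1 \<Longrightarrow> length (beta_tilde \<beta> k) = 2 * (3 * k - 1) + 1"
  by (simp add: beta_tilde_eq del: upt_Suc)

lemma beta_tilde_nth: "k \<ge> 1 \<Longrightarrow> m \<le> 2 * (3 * k - 1) \<Longrightarrow> beta_tilde \<beta> k ! m = cusp_seq \<beta> (m + 2)"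
  by (simp add: beta_tilde_eq del: upt_Suc)

lemma riesz_shift_square: "riesz (\<lambda>i. g (i + 2)) (q * q) = riesz g ((q * monom 1 1) * (q * monom 1 1))"
proof -
  have "(q * a) * (q * a) = q * q * (a * a)" for a by (simp only: mult_ac)
  moreover have "monom 1 1 * monom 1 1 = monom (1::real) 2" by (simp add: mult_monom numeral_2_eq_2)
  ultimately show ?thesis by (simp only: riesz_shift)
qed

lemma mult_monom_1_properties:
  fixes q :: "real poly"
  shows "degree q \<le> n \<Longrightarrow> degree (q * monom 1 1) \<le> Suc n"
    and "coeff (q * monom 1 1) 0 = 0"
    and "q \<noteq> 0 \<Longrightarrow> q * monom 1 1 \<noteq> 0"
  using degree_mult_le[of q "monom 1 1"] by (auto simp: degree_monom_eq coeff_mult)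

lemma seq_rank_beta_tilde_definite:
  assumes k: "k \<ge> 1" and pd: "pos_def (hankel (beta_tilde \<beta> k))"
  shows "seq_rank (beta_tilde \<beta> k) = 3 * k"
proof -
  have def: "riesz (\<lambda>i. cusp_seq \<beta> (i + 2)) (q * q) \<noteq> 0" if "q \<noteq> 0" "degree q < 3 * k" for q
  proof -
    have "degree (q * monom 1 1) \<le> Suc (3 * k - 1)"
      using that(2) by (intro mult_monom_1_properties(1)) simp
    then have "riesz (cusp_seq \<beta>) ((q * monom 1 1) * (q * monom 1 1)) > 0"
      using pd[unfolded pos_def_hankel_tilde[OF k]] mult_monom_1_properties(2,3)[of q] that(1) k by simp
    then show ?thesis unfolding riesz_shift_square by simp
  qed
  have "invertible_mat (hankel (beta_tilde \<beta> k))"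
    unfolding hankel_tilde[OF k]
  proof (rule solvable_of_trivial_kernel(2))
    fix x assume x: "\<And>i. i < 3 * k \<Longrightarrow> (\<Sum>j<3 * k. cusp_seq \<beta> (i + j + 2) * x j) = 0"
    have "(\<Sum>j<3 * k. x j * cusp_seq \<beta> (i + j + 2)) = 0" if "i < 3 * k" for i
      using x[OF that] by (subst mult.commute)
    then show "\<forall>j<3 * k. x j = 0"
      by (intro hankel_columns_independent[where g = "\<lambda>i. cusp_seq \<beta> (i + 2)"] def)
  qed
  moreover have "length (beta_tilde \<beta> k) div 2 + 1 = 3 * k"
    using k by (simp add: length_beta_tilde)
  ultimately show ?thesis by (simp add: seq_rank_def Let_def)
qed

lemma cusp_exponent_neq_1: "2 * i + 3 * j \<noteq> (1::nat)"
  by presburger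

lemma definite_case_measure:
  assumes k: "k \<ge> 1" and psd: "pos_semidef (moment_matrix \<beta> k)"
    and \<beta>: "\<And>i j. i + j \<le> 2 * k \<Longrightarrow> \<beta> i j = cusp_seq \<beta> (2 * i + 3 * j)"
    and pd: "cond2a \<beta> k"
  shows "\<exists>\<mu>. representing_measure \<beta> k cusp_curve \<mu> \<and> atomic_measure (seq_rank (beta_tilde \<beta> k)) \<mu>"
proof -
  have pd': "pos_def (hankel (beta_tilde \<beta> k))" "pos_def (A_tilde \<beta> k)"
    using pd by (simp_all add: cond2a_def)
  have psd': "riesz (cusp_seq \<beta>) (f * f) \<ge> 0" if "degree f \<le> 3 * k" "coeff f 1 = 0" for f
  proof -
    have "pos_semidef (moment_matrix \<beta> k) \<longleftrightarrow>
        (\<forall>f. degree f \<le> 3 * k \<and> coeff f 1 = 0 \<longrightarrow> riesz (cusp_seq \<beta>) (f * f) \<ge> 0)"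
      by (rule pos_semidef_moment_matrix[OF k]) (rule \<beta>)
    then show ?thesis using psd that by blast
  qed
  obtain x S w where S: "finite S" "card S = 3 * k" "\<And>s. s \<in> S \<Longrightarrow> w s > 0"
    and quad: "\<And>h. degree h \<le> 2 * (3 * k) \<Longrightarrow> riesz ((cusp_seq \<beta>)(1 := x)) h = (\<Sum>s\<in>S. w s * poly h s)"
  proof (rule definite_completion_atoms[of "3 * k" "cusp_seq \<beta>"])
    show "3 * k \<ge> 2" using k by simp
    show "riesz (cusp_seq \<beta>) (f * f) > 0" if "f \<noteq> 0" "degree f \<le> 3 * k" "coeff f 0 = 0" for f
      using pd'(1) that unfolding pos_def_hankel_tilde[OF k] by blast
    show "riesz (cusp_seq \<beta>) (f * f) \<ge> 0" if "degree f \<le> 3 * k" "coeff f 1 = 0" for f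
      using that by (rule psd')
    show "riesz (cusp_seq \<beta>) (f * f) > 0" if "f \<noteq> 0" "degree f < 3 * k" "coeff f 1 = 0" for f
      using pd'(2) that unfolding pos_def_A_tilde[OF k] by blast
  qed metis
  \<comment> \<open>The value x chosen for the moment of t stays invisible, because 2i + 3j is never
    1.\<close>
  have "\<beta> i j = (\<Sum>s\<in>S. w s * s ^ (2 * i + 3 * j))" if "i + j \<le> 2 * k" for i j
  proof -
    let ?m = "2 * i + 3 * j"
    have "\<beta> i j = riesz ((cusp_seq \<beta>)(1 := x)) (monom 1 ?m)"
      using \<beta>[OF that] cusp_exponent_neq_1[of i j] by (simp add: riesz_monom)
    also have "\<dots> = (\<Sum>s\<in>S. w s * poly (monom 1 ?m) s)"
      using that by (intro quad) (simp add: degree_monom_eq)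
    finally show ?thesis by (simp add: poly_monom)
  qed
  from atoms_representing_measure[OF S(1,3) this]
  show ?thesis unfolding seq_rank_beta_tilde_definite[OF k pd'(1)] S(2) .
qed

text \<open>The nonzero atoms are fixed by the moments of order at least 2, and
  \<open>seq_rank (beta_tilde \<beta> k)\<close> is their number. The cusp point is a further atom
  exactly when the defect \<open>c\<close> in the moment of 1 is positive, and the rank of M(k)
  detects this because it counts all atoms.\<close>

lemma flat_case_measure:
  assumes k: "k \<ge> 1" and psd: "pos_semidef (moment_matrix \<beta> k)"
    and \<beta>: "\<And>i j. i + j \<le> 2 * k \<Longrightarrow> \<beta> i j = cusp_seq \<beta> (2 * i + 3 * j)"
    and flat: "cond2b \<beta> k"
  shows "\<exists>\<mu>. representing_measure \<beta> k cusp_curve \<mu> \<and>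
    atomic_measure (if mat_rank (hankel (beta_hat \<beta> k)) = mat_rank (moment_matrix \<beta> k)
      then seq_rank (beta_tilde \<beta> k) else seq_rank (beta_tilde \<beta> k) + 1) \<mu>"
proof -
  let ?G = "cusp_seq \<beta>" and ?N = "3 * k - 1"
  have N: "Suc ?N = 3 * k" using k by simp
  obtain S v where S: "finite S" "card S \<le> ?N" "0 \<notin> S" and v: "\<And>s. s \<in> S \<Longrightarrow> v s > 0"
    and atoms: "\<And>m. m \<le> 2 * ?N \<Longrightarrow> ?G (m + 2) = (\<Sum>s\<in>S. v s * s ^ m)"
  proof (rule flat_hankel_atoms[of ?N "\<lambda>m. ?G (m + 2)"])
    fix f :: "real poly" assume "degree f \<le> ?N"
    then have "degree (f * monom 1 1) \<le> 3 * k" using mult_monom_1_properties(1)[of f ?N] N by simp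
    then show "riesz (\<lambda>m. ?G (m + 2)) (f * f) \<ge> 0"
      using flat mult_monom_1_properties(2)[of f]
      unfolding riesz_shift_square cond2b_def pos_semidef_hankel_tilde[OF k] by blast
  next
    show "mat_rank (hankel_form ?N (\<lambda>m. ?G (m + 2))) = mat_rank (hankel_form (Suc ?N) (\<lambda>m. ?G (m + 2)))"
      using flat unfolding N cond2b_def hankel_hat[OF k] hankel_tilde[OF k] by blast
    have shift: "m + 2 + 2 = m + (4::nat)" for m by simp
    have "mat_rank (hankel (beta_breve \<beta> k)) = mat_rank (hankel (beta_tilde \<beta> k))"
      using flat by (simp add: cond2b_def)
    then show "mat_rank (hankel_form ?N (\<lambda>m. ?G (m + 2 + 2))) = mat_rank (hankel_form (Suc ?N) (\<lambda>m. ?G (m + 2)))"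
      unfolding N shift hankel_breve[OF k] hankel_tilde[OF k] .
  qed metis
  have rank_hat: "mat_rank (hankel (beta_hat \<beta> k)) = card S"
    unfolding hankel_hat[OF k]
    by (intro mat_rank_hankel_form_atoms[where w = v] S atoms) (use v in force)+
  have seq_rank: "seq_rank (beta_tilde \<beta> k) = card S"
    by (rule seq_rank_atoms[OF length_beta_tilde[OF k] S(1,2) v])
      (simp_all only: beta_tilde_nth[OF k] atoms)
  define c where "c = ?G 0 - (\<Sum>s\<in>S. v s / s\<^sup>2)"
  define W where "W s = (if s = 0 then c else v s / s\<^sup>2)" for s
  define T where "T = insert 0 S"
  have T: "finite T" "card T = Suc (card S)" using S by (simp_all add: T_def)
  have W_S: "W s = v s / s\<^sup>2" "s \<noteq> 0" "W s > 0" if "s \<in> S" for s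
  proof -
    show "s \<noteq> 0" using that S(3) by auto
    then show "W s = v s / s\<^sup>2" "W s > 0" using v[OF that] by (simp_all add: W_def)
  qed
  have G_T: "?G m = (\<Sum>s\<in>T. W s * s ^ m)" if m: "m \<noteq> 1" "m \<le> 6 * k" for m
  proof -
    have sum_T: "(\<Sum>s\<in>T. W s * s ^ m) = c * 0 ^ m + (\<Sum>s\<in>S. W s * s ^ m)"
      using S by (simp add: T_def W_def)
    show ?thesis
    proof (cases "m = 0")
      case True
      then show ?thesis using sum_T W_S(1) by (simp add: c_def)
    next
      case False
      then have 2: "m = (m - 2) + 2" "m - 2 \<le> 2 * ?N" using m k by simp_all
      have "?G m = (\<Sum>s\<in>S. v s * s ^ (m - 2))" using atoms[OF 2(2)] 2(1) by simp
      also have "\<dots> = (\<Sum>s\<in>S. W s * s ^ m)"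
      proof (rule sum.cong)
        fix s assume "s \<in> S"
        moreover have "s ^ m = s ^ (m - 2) * s\<^sup>2" by (metis 2(1) power_add)
        ultimately show "v s * s ^ (m - 2) = W s * s ^ m" using W_S by simp
      qed simp
      finally show ?thesis using sum_T False by simp
    qed
  qed
  \<comment> \<open>\<open>P\<close> is normalized to 1 at 0 and vanishes on \<open>S\<close>. The
    extra linear factor of \<open>p\<close> cancels its linear coefficient; the degree becomes at
    most \<open>card S + 1\<close>, which is still within 3k.\<close>
  define P where "P = (\<Prod>s\<in>S. [:1, - 1 / s:])"
  define p where "p = [:1, - coeff P 1:] * P"
  have "poly P 0 = 1" by (simp add: P_def poly_prod)
  then have P0: "coeff P 0 = 1" by (simp add: poly_0_coeff_0)
  have p1: "coeff p 1 = 0" using P0 by (simp add: p_def)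
  have p_T: "poly p s = (if s = 0 then 1 else 0)" if "s \<in> T" for s
  proof (cases "s = 0")
    case True
    then show ?thesis using \<open>poly P 0 = 1\<close> by (simp add: p_def)
  next
    case False
    then have "poly P s = 0" using that S(1) by (auto simp: T_def P_def poly_prod prod_zero_iff intro!: bexI[of _ s])
    then show ?thesis using False by (simp add: p_def)
  qed
  have "degree P \<le> (\<Sum>s\<in>S. degree [:1, - 1 / s:])"
    unfolding P_def using degree_prod_sum_le[OF S(1), of "\<lambda>s. [:1, - 1 / s:]"] by (simp add: comp_def)
  also have "\<dots> \<le> (\<Sum>s\<in>S. 1)" by (intro sum_mono) simp
  finally have "degree P \<le> card S" by simp
  moreover have "degree [:1, - coeff P 1:] \<le> 1" by simp
  moreover have "degree p \<le> degree [:1, - coeff P 1:] + degree P"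
    unfolding p_def by (rule degree_mult_le)
  ultimately have dp: "degree p \<le> 3 * k" using S(2) N by linarith
  have psd': "riesz (cusp_seq \<beta>) (f * f) \<ge> 0" if "degree f \<le> 3 * k" "coeff f 1 = 0" for f
  proof -
    have "pos_semidef (moment_matrix \<beta> k) \<longleftrightarrow>
        (\<forall>f. degree f \<le> 3 * k \<and> coeff f 1 = 0 \<longrightarrow> riesz (cusp_seq \<beta>) (f * f) \<ge> 0)"
      by (rule pos_semidef_moment_matrix[OF k]) (rule \<beta>)
    then show ?thesis using psd that by blast
  qed
  have c: "c \<ge> 0"
  proof -
    have dpp: "degree (p * p) \<le> 6 * k" using degree_mult_le[of p p] dp by simp
    have "0 \<le> riesz ?G (p * p)"
      using dp p1 by (rule psd')
    also have "\<dots> = riesz (\<lambda>m. \<Sum>s\<in>T. W s * s ^ m) (p * p)"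
    proof (rule riesz_cong)
      fix i assume i: "i \<le> degree (p * p)" "coeff (p * p) i \<noteq> 0"
      have "coeff (p * p) 1 = 0" using p1 by (simp add: coeff_mult atMost_Suc)
      then show "?G i = (\<Sum>s\<in>T. W s * s ^ i)" using i dpp by (intro G_T) auto
    qed
    also have "\<dots> = (\<Sum>s\<in>T. W s * poly (p * p) s)" by (rule riesz_atoms[OF refl dpp])
    also have "\<dots> = (\<Sum>s\<in>T. if s = 0 then c else 0)"
      by (intro sum.cong) (auto simp: p_T W_def)
    also have "\<dots> = c" using T(1) by (simp add: T_def)
    finally show ?thesis .
  qed
  define U where "U = {s \<in> T. W s \<noteq> 0}"
  have "W 0 \<ge> 0" using c by (simp add: W_def)
  then have U: "finite U" "\<And>s. s \<in> U \<Longrightarrow> W s > 0"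
    using T(1) W_S(3) by (auto simp: U_def T_def order.not_eq_order_implies_strict)
  have G_U: "?G m = (\<Sum>s\<in>U. W s * s ^ m)" if m: "m \<noteq> 1" "m \<le> 6 * k" for m
    unfolding G_T[OF m] using T(1) by (intro sum.mono_neutral_right) (auto simp: U_def)
  have rank_M: "mat_rank (moment_matrix \<beta> k) = card U"
  proof -
    let ?e = "monomial_exponent k" and ?L = "length (monomials k)"
    have e: "?e r \<le> 3 * k" if "r < ?L" for r
      using image_monomial_exponent[OF k] that by blast
    have e1: "?e r + ?e c \<noteq> 1" for r c unfolding monomial_exponent_def by presburger
    have M: "moment_matrix \<beta> k = Matrix.mat ?L ?L (\<lambda>(r, c). ?G (?e r + ?e c))"
      by (rule moment_matrix_eq) (rule \<beta>)
    show ?thesis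
      unfolding M
    proof (rule mat_rank_sum_atoms[where w = W and b = "\<lambda>s r. s ^ ?e r"])
      show "Matrix.mat ?L ?L (\<lambda>(r, c). ?G (?e r + ?e c)) $$ (i, j) = (\<Sum>s\<in>U. W s * s ^ ?e i * s ^ ?e j)"
        if "i < ?L" "j < ?L" for i j
      proof -
        have "?e i + ?e j \<le> 6 * k" using e[OF that(1)] e[OF that(2)] by simp
        then show ?thesis using that G_U[OF e1] by (simp add: power_add mult.assoc)
      qed
      show "\<exists>x. \<forall>t\<in>U. (\<Sum>j<?L. x j * t ^ ?e j) = (if t = s then 1 else 0)" if s: "s \<in> U" for s
      proof -
        \<comment> \<open>Separating polynomials must lie in the span of 1, t^2, ..., t^(3k). For s
          = 0 this is \<open>p\<close>. For s in \<open>S\<close> the Lagrange polynomial of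
          \<open>S\<close> is multiplied by (t / s)^2, which removes the low coefficients, also
          gives a zero at 0, and keeps the degree at most \<open>card S + 1\<close>.\<close>
        have "\<exists>f. degree f \<le> 3 * k \<and> coeff f 1 = 0 \<and> (\<forall>t\<in>T. poly f t = (if t = s then 1 else 0))"
        proof (cases "s = 0")
          case True
          then show ?thesis using dp p1 p_T by blast
        next
          case False
          then have sS: "s \<in> S" using s by (simp add: U_def T_def)
          let ?f = "lagrange S s * monom (1 / s\<^sup>2) 2"
          have "degree ?f \<le> 3 * k"
            using degree_mult_le[of "lagrange S s" "monom (1 / s\<^sup>2) 2"] degree_lagrange[OF S(1) sS]
              degree_monom_le[of "1 / s\<^sup>2" 2] S(2) N by simp
          moreover have "coeff ?f 1 = 0" by (simp add: coeff_mult atMost_Suc)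
          moreover have "poly ?f t = (if t = s then 1 else 0)" if "t \<in> T" for t
            using that poly_lagrange[OF S(1) sS, of t] False by (auto simp: T_def poly_monom)
          ultimately show ?thesis by blast
        qed
        then obtain f where f: "degree f \<le> 3 * k" "coeff f 1 = 0"
          "\<And>t. t \<in> T \<Longrightarrow> poly f t = (if t = s then 1 else 0)" by metis
        have "\<forall>m. coeff f m \<noteq> 0 \<longrightarrow> m \<in> ?e ` {..<?L}"
          unfolding image_monomial_exponent[OF k] coeff_support_iff using f(1,2) by blast
        then obtain x where x: "f = (\<Sum>r<?L. monom (x r) (?e r))"
          using poly_eq_sum_monom_image[of f ?e ?L] by metis
        have "(\<Sum>j<?L. x j * t ^ ?e j) = poly f t" for t
          unfolding x by (simp add: poly_sum poly_monom)
        then show ?thesis using f(3) by (intro exI[of _ x]) (simp add: U_def)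
      qed
    qed (use U in \<open>auto simp: U_def\<close>)
  qed
  \<comment> \<open>As \<open>card S\<close> is the rank of the \<open>beta_hat\<close> matrix and
    \<open>card U\<close> that of M(k), equality of these ranks says precisely that \<open>c\<close>
    is zero.\<close>
  have card_U: "card U = (if c = 0 then card S else card S + 1)"
  proof (cases "c = 0")
    case True
    then have "U = S" using W_S(3) S(3) by (force simp: U_def T_def W_def)
    then show ?thesis using True by simp
  next
    case False
    then have "U = T" using W_S(3) by (force simp: U_def T_def W_def)
    then show ?thesis using False T(2) by simp
  qed
  have "\<beta> i j = (\<Sum>s\<in>U. W s * s ^ (2 * i + 3 * j))" if "i + j \<le> 2 * k" for i j
    unfolding \<beta>[OF that] using that by (intro G_U cusp_exponent_neq_1) simp
  from atoms_representing_measure[OF U this]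
  show ?thesis using card_U by (simp add: rank_hat rank_M seq_rank split: if_splits)
qed

theorem corollary4p4:
  fixes k :: nat and \<beta> :: "nat \<Rightarrow> nat \<Rightarrow> real"
  assumes "k \<ge> 1"
    and "pos_semidef (moment_matrix \<beta> k)"
    and "recursively_generated \<beta> k"
  shows "((\<exists>\<mu>. representing_measure \<beta> k cusp_curve \<mu>) \<longleftrightarrow>
            cond1 \<beta> k \<and> (cond2a \<beta> k \<or> cond2b \<beta> k)) \<and>
         ((\<exists>\<mu>. representing_measure \<beta> k cusp_curve \<mu>) \<longrightarrow>
            (if cond2a \<beta> k \<or>
                (cond2b \<beta> k \<and>
                 mat_rank (hankel (beta_hat \<beta> k)) = mat_rank (moment_matrix \<beta> k))
             then \<exists>\<mu>. representing_measure \<beta> k cusp_curve \<mu> \<and>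
                       atomic_measure (seq_rank (beta_tilde \<beta> k)) \<mu>
             else \<exists>\<mu>. representing_measure \<beta> k cusp_curve \<mu> \<and>
                       atomic_measure (seq_rank (beta_tilde \<beta> k) + 1) \<mu>))"
proof -
  have necessary: "cond1 \<beta> k \<and> (cond2a \<beta> k \<or> cond2b \<beta> k)"
    if "\<exists>\<mu>. representing_measure \<beta> k cusp_curve \<mu>"
    using that representing_measure_imp_conditions[OF assms(1)] by blast
  \<comment> \<open>Only here do recursive generation and condition (1) enter: they make the
    multisequence depend on 2i + 3j alone, after which the problem is univariate.\<close>
  have consistent: "\<beta> i j = cusp_seq \<beta> (2 * i + 3 * j)" if "cond1 \<beta> k" "i + j \<le> 2 * k" for i j
    by (rule cusp_seq_eq[OF _ that(2)]) (rule cusp_relation[OF assms(3) that(1)])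
  have sufficient: "if cond2a \<beta> k \<or>
                (cond2b \<beta> k \<and>
                 mat_rank (hankel (beta_hat \<beta> k)) = mat_rank (moment_matrix \<beta> k))
             then \<exists>\<mu>. representing_measure \<beta> k cusp_curve \<mu> \<and>
                       atomic_measure (seq_rank (beta_tilde \<beta> k)) \<mu>
             else \<exists>\<mu>. representing_measure \<beta> k cusp_curve \<mu> \<and>
                       atomic_measure (seq_rank (beta_tilde \<beta> k) + 1) \<mu>"
    if "cond1 \<beta> k" "cond2a \<beta> k \<or> cond2b \<beta> k"
  proof (cases "cond2a \<beta> k")
    case True
    have "\<exists>\<mu>. representing_measure \<beta> k cusp_curve \<mu> \<and> atomic_measure (seq_rank (beta_tilde \<beta> k)) \<mu>"
      by (rule definite_case_measure[OF assms(1,2) _ True]) (rule consistent[OF that(1)])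
    then show ?thesis using True by simp
  next
    case False
    then have flat: "cond2b \<beta> k" using that(2) by blast
    have "\<exists>\<mu>. representing_measure \<beta> k cusp_curve \<mu> \<and>
        atomic_measure (if mat_rank (hankel (beta_hat \<beta> k)) = mat_rank (moment_matrix \<beta> k)
          then seq_rank (beta_tilde \<beta> k) else seq_rank (beta_tilde \<beta> k) + 1) \<mu>"
      by (rule flat_case_measure[OF assms(1,2) _ flat]) (rule consistent[OF that(1)])
    then show ?thesis using False flat by (simp split: if_splits)
  qed
  then have "\<exists>\<mu>. representing_measure \<beta> k cusp_curve \<mu>"
    if "cond1 \<beta> k" "cond2a \<beta> k \<or> cond2b \<beta> k"
    using that by (metis (full_types))
  then show ?thesis using necessary sufficient by blast
qed

end
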